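(* For every $0\le\alpha<1$ and every $1<p<\infty$ there is a Schauder basis $\mathcal{X}_\alpha$ of $\ell_p$ with \[ \boldsymbol{k}_m[\mathcal{X}_\alpha,\ell_p]\approx m^\alpha,\qquad m\in\mathbb{N}. \]
   Context: Spaces are over the real or complex field. For a Schauder basis $\mathcal{X}=(\boldsymbol{x}_n)_{n=1}^\infty$ of a Banach space $\mathbb{X}$ with coordinate functionals $(\boldsymbol{x}_n^* )_{n=1}^\infty$ and a finite set $A\subseteq\mathbb{N}$, let $S_A(f)=\sum_{n\in A}\boldsymbol{x}_n^*(f)\,\boldsymbol{x}_n$ for $f\in\mathbb{X}$. The conditionality constants are $\boldsymbol{k}_m[\mathcal{X},\mathbb{X}]=\sup_{|A|\le m}\|S_A\|$, $m\in\mathbb{N}$. The notation $a_m\approx b_m$ for $m\in\mathbb N$ means that there are constants $0<c\le C<\infty$ with $c\,b_m\le a_m\le C\,b_m$ for all $m\in\mathbb{N}$. *)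

theory Defs
  imports "HOL-Analysis.Analysis"
begin

text \<open>A space of scalar families is given by its carrier \<open>V\<close> and its norm \<open>N\<close>, with the pointwise
  vector space operations. The exponent of \<open>\<ell>\<^sub>p\<close> is a real variable, so \<open>\<ell>\<^sub>p\<close> cannot be a type
  instantiating \<open>banach\<close>. Sequences and bases are indexed from 0.\<close>

definition lp_space :: "real \<Rightarrow> (nat \<Rightarrow> 'k::real_normed_field) set" where
  "lp_space p = {f. summable (\<lambda>i. norm (f i) powr p)}"

definition lp_norm :: "real \<Rightarrow> (nat \<Rightarrow> 'k::real_normed_field) \<Rightarrow> real" where
  "lp_norm p f = (\<Sum>i. norm (f i) powr p) powr (1 / p)"

definition expands ::
    "(('i \<Rightarrow> 'k::real_normed_field) \<Rightarrow> real) \<Rightarrow> (nat \<Rightarrow> 'i \<Rightarrow> 'k) \<Rightarrow> ('i \<Rightarrow> 'k) \<Rightarrow> (nat \<Rightarrow> 'k) \<Rightarrow> bool" where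
  "expands N X f a \<longleftrightarrow> (\<lambda>M. N (\<lambda>i. f i - (\<Sum>n<M. a n * X n i))) \<longlonglongrightarrow> 0"

definition schauder_basis ::
    "('i \<Rightarrow> 'k::real_normed_field) set \<Rightarrow> (('i \<Rightarrow> 'k) \<Rightarrow> real) \<Rightarrow> (nat \<Rightarrow> 'i \<Rightarrow> 'k) \<Rightarrow> bool" where
  "schauder_basis V N X \<longleftrightarrow> (\<forall>n. X n \<in> V) \<and> (\<forall>f\<in>V. \<exists>!a. expands N X f a)"

text \<open>The coordinate functionals and the operators \<open>S\<^sub>A\<close>; meaningful only when \<open>X\<close> is a Schauder
  basis and \<open>f\<close> lies in the space.\<close>

definition coord_functional ::
    "(('i \<Rightarrow> 'k::real_normed_field) \<Rightarrow> real) \<Rightarrow> (nat \<Rightarrow> 'i \<Rightarrow> 'k) \<Rightarrow> nat \<Rightarrow> ('i \<Rightarrow> 'k) \<Rightarrow> 'k" where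
  "coord_functional N X n f = (THE a. expands N X f a) n"

definition coord_projection ::
    "(('i \<Rightarrow> 'k::real_normed_field) \<Rightarrow> real) \<Rightarrow> (nat \<Rightarrow> 'i \<Rightarrow> 'k) \<Rightarrow> nat set \<Rightarrow> ('i \<Rightarrow> 'k) \<Rightarrow> ('i \<Rightarrow> 'k)" where
  "coord_projection N X A f = (\<lambda>i. \<Sum>n\<in>A. coord_functional N X n f * X n i)"

text \<open>Suprema are taken in \<^typ>\<open>ennreal\<close>, so that an unbounded family would have supremum
  \<open>\<infinity>\<close> instead of the unspecified value of \<open>Sup\<close> on \<^typ>\<open>real\<close>.\<close>

definition operator_norm ::
    "('i \<Rightarrow> 'k::real_normed_field) set \<Rightarrow> (('i \<Rightarrow> 'k) \<Rightarrow> real) \<Rightarrow> (('i \<Rightarrow> 'k) \<Rightarrow> ('i \<Rightarrow> 'k)) \<Rightarrow> ennreal" where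
  "operator_norm V N T = (SUP f\<in>{f\<in>V. N f \<le> 1}. ennreal (N (T f)))"

definition conditionality_const ::
    "('i \<Rightarrow> 'k::real_normed_field) set \<Rightarrow> (('i \<Rightarrow> 'k) \<Rightarrow> real) \<Rightarrow> (nat \<Rightarrow> 'i \<Rightarrow> 'k) \<Rightarrow> nat \<Rightarrow> ennreal" where
  "conditionality_const V N X m =
     (SUP A\<in>{A. finite A \<and> card A \<le> m}. operator_norm V N (coord_projection N X A))"

text \<open>The relation \<open>a\<^sub>m \<approx> b\<^sub>m\<close>, over the positive integers.\<close>

definition equiv_growth :: "(nat \<Rightarrow> ennreal) \<Rightarrow> (nat \<Rightarrow> real) \<Rightarrow> bool" where
  "equiv_growth a b \<longleftrightarrow>
     (\<exists>c C. 0 < c \<and> c \<le> C \<and> (\<forall>m\<ge>1. ennreal (c * b m) \<le> a m \<and> a m \<le> ennreal (C * b m)))"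

end

theory Submission
  imports Defs
begin

text \<open>Let \<open>T\<^sub>a\<close> be convolution with the coefficients \<open>cesaro a n\<close> of \<open>(1 - z) powr - a\<close>, so that
  \<open>T\<^sub>a T\<^sub>b = T\<^bsub>a + b\<^esub>\<close>. For \<open>- 1 / p < a < 1 - 1 / p\<close> the vectors \<open>T\<^sub>a e\<^sub>n\<close> form a basis of \<open>\<ell>\<^sub>p\<close>:
  the \<open>N\<close>-th partial sum operator is the \<open>N\<close>-th coordinate truncation plus a corner whose kernel has a
  closed form comparable to \<open>(u / v) powr a / (u + v)\<close>, which the Schur test handles like Hilbert's matrix.
  The sum of the first \<open>m\<close> vectors has norm about \<open>m powr (1 / p + a)\<close>. Pairing the basis \<open>x\<^sub>n\<close> with
  parameter \<open>- b\<close> and the basis \<open>y\<^sub>n\<close> with parameter \<open>a\<close> into the basis \<open>(x\<^sub>n, y\<^sub>n), (0, y\<^sub>n)\<close> of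
  \<open>\<ell>\<^sub>p \<oplus> \<ell>\<^sub>p = \<ell>\<^sub>p\<close>, projecting \<open>(x\<^sub>1 + \<dots> + x\<^sub>m, 0)\<close> onto the first kind of vectors multiplies the
  norm by about \<open>m powr (a + b)\<close>; restricting the convolutions to \<open>m\<close> indices shows that this is the
  worst case. With \<open>b = \<alpha> / p\<close> and \<open>a = \<alpha> * (1 - 1 / p)\<close> every \<open>\<alpha> < 1\<close> is reached.\<close>

subsection \<open>Power means, the Schur test and power sums\<close>

text \<open>The range of \<open>a\<close> can be read off the corner kernel
  \<open>(u / v) powr a / (u + v)\<close>: its columns are p-th power summable exactly for
  \<open>a < 1 - 1 / p\<close>, its rows lie in the dual sequence space exactly for
  \<open>a > - 1 / p\<close>. For \<open>a > 0\<close> the coefficients of \<open>T\<^sub>a\<close>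
  decay like \<open>n powr (a - 1)\<close> and are not summable, so \<open>T\<^sub>a\<close> is
  unbounded on the space; this is the source of all growth. For \<open>0 \<le> a \<le> 1\<close> the
  coefficients of the inverse operator have absolute sum at most 2. A positive parameter thus costs
  a power of \<open>m\<close>, a negative one a constant. With one of the two parameters zero only
  exponents below \<open>1 - 1 / p\<close> or below \<open>1 / p\<close> arise; pairing adds them,
  and the two limits have sum 1 whatever \<open>p\<close> is. The mechanism is cancellation: a
  vector with second component zero has opposite coefficients along the two kinds of basis vectors,
  and a projection onto one kind destroys this. Convergence of expansions comes from a direct
  estimate of the remainder, uniqueness from the triangular shape of the vectors.\<close>

lemma weighted_power_mean:
  fixes w x :: "'a \<Rightarrow> real"
  assumes "finite J" and p: "1 < p"
    and w: "\<And>j. j \<in> J \<Longrightarrow> 0 \<le> w j" and x: "\<And>j. j \<in> J \<Longrightarrow> 0 \<le> x j"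
  shows "(\<Sum>j\<in>J. w j * x j) powr p \<le> (\<Sum>j\<in>J. w j) powr (p - 1) * (\<Sum>j\<in>J. w j * x j powr p)"
proof -
  define W where "W = (\<Sum>j\<in>J. w j)"
  define s where "s = (\<Sum>j\<in>J. w j * x j)"
  have W0: "W \<ge> 0" unfolding W_def by (intro sum_nonneg w)
  have s0: "s \<ge> 0" unfolding s_def by (intro sum_nonneg mult_nonneg_nonneg w x)
  show ?thesis
  proof (cases "s = 0")
    case True
    then show ?thesis using p w by (auto simp: s_def[symmetric] intro!: mult_nonneg_nonneg sum_nonneg)
  next
    case False
    have "W \<noteq> 0"
    proof
      assume "W = 0"
      then have "\<forall>j\<in>J. w j = 0" using sum_nonneg_eq_0_iff[OF assms(1)] w by (auto simp: W_def)
      then have "s = 0" by (simp add: s_def)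
      then show False using False by simp
    qed
    with False W0 s0 have W: "W > 0" and s: "s > 0" by auto
    define \<mu> where "\<mu> = s / W"
    have \<mu>: "\<mu> > 0" using W s by (simp add: \<mu>_def)
    \<comment> \<open>The tangent line of the p-th power at \<mu> lies below the graph. Summed with
      the weights this is Jensen's inequality; since \<mu> is the weighted mean, the linear terms
      collapse to \<open>\<mu> powr p * W\<close>.\<close>
    have young: "p * \<mu> powr (p - 1) * y - (p - 1) * \<mu> powr p \<le> y powr p" if "y \<ge> 0" for y
    proof -
      have "y * \<mu> powr (p - 1) \<le> y powr p / p + (\<mu> powr (p - 1)) powr (p / (p - 1)) / (p / (p - 1))"
        by (rule Youngs_inequality) (use p that \<mu> in \<open>auto simp: field_simps\<close>)
      also have "(\<mu> powr (p - 1)) powr (p / (p - 1)) = \<mu> powr p"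
        using p by (simp add: powr_powr)
      finally show ?thesis using p by (simp add: field_simps)
    qed
    have "(\<Sum>j\<in>J. w j * (p * \<mu> powr (p - 1) * x j - (p - 1) * \<mu> powr p)) \<le> (\<Sum>j\<in>J. w j * x j powr p)"
      by (intro sum_mono mult_left_mono young x w)
    also have "(\<Sum>j\<in>J. w j * (p * \<mu> powr (p - 1) * x j - (p - 1) * \<mu> powr p))
        = p * \<mu> powr (p - 1) * s - (p - 1) * \<mu> powr p * W"
      by (simp add: s_def W_def right_diff_distrib sum_subtractf sum_distrib_left sum_distrib_right mult_ac)
    also have "s = \<mu> * W" using W by (simp add: \<mu>_def)
    also have "p * \<mu> powr (p - 1) * (\<mu> * W) - (p - 1) * \<mu> powr p * W = \<mu> powr p * W"
      using \<mu> powr_add[of \<mu> "p - 1" 1] by (simp add: algebra_simps)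
    finally have le: "\<mu> powr p * W \<le> (\<Sum>j\<in>J. w j * x j powr p)" .
    have "s powr p = W powr (p - 1) * (\<mu> powr p * W)"
      using W s powr_add[of W "p - 1" 1] by (simp add: \<mu>_def powr_divide)
    also have "\<dots> \<le> W powr (p - 1) * (\<Sum>j\<in>J. w j * x j powr p)"
      by (intro mult_left_mono le) auto
    finally show ?thesis by (simp add: W_def s_def)
  qed
qed

text \<open>With \<open>x j\<close> written as \<open>w j * (x j / w j)\<close>, the weighted power
  mean for the weights \<open>K i j * w j\<close> lets the row condition bound the total weight;
  interchanging the two sums leaves exactly the column condition.\<close>

lemma schur_test:
  fixes K :: "'a \<Rightarrow> 'b \<Rightarrow> real"
  assumes fin: "finite I" "finite J" and p: "1 < p"
    and K: "\<And>i j. i \<in> I \<Longrightarrow> j \<in> J \<Longrightarrow> 0 \<le> K i j" and x: "\<And>j. j \<in> J \<Longrightarrow> 0 \<le> x j"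
    and h: "\<And>i. i \<in> I \<Longrightarrow> 0 < h i" and w: "\<And>j. j \<in> J \<Longrightarrow> 0 < w j" and R: "0 \<le> R"
    and row: "\<And>i. i \<in> I \<Longrightarrow> (\<Sum>j\<in>J. K i j * w j) \<le> R * h i"
    and col: "\<And>j. j \<in> J \<Longrightarrow> (\<Sum>i\<in>I. K i j * h i powr (p - 1)) \<le> S * w j powr (p - 1)"
  shows "(\<Sum>i\<in>I. (\<Sum>j\<in>J. K i j * x j) powr p) \<le> R powr (p - 1) * S * (\<Sum>j\<in>J. x j powr p)"
proof -
  have "(\<Sum>j\<in>J. K i j * x j) powr p
      \<le> R powr (p - 1) * (\<Sum>j\<in>J. K i j * h i powr (p - 1) * (x j powr p * w j powr (1 - p)))" if i: "i \<in> I" for i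
  proof -
    have "(\<Sum>j\<in>J. K i j * x j) = (\<Sum>j\<in>J. (K i j * w j) * (x j / w j))"
      by (intro sum.cong) (use w in fastforce)+
    also have "\<dots> powr p \<le> (\<Sum>j\<in>J. K i j * w j) powr (p - 1) * (\<Sum>j\<in>J. (K i j * w j) * (x j / w j) powr p)"
      by (rule weighted_power_mean) (use fin p K[OF i] x w in \<open>auto intro!: mult_nonneg_nonneg divide_nonneg_nonneg simp: less_imp_le\<close>)
    also have "\<dots> \<le> (R * h i) powr (p - 1) * (\<Sum>j\<in>J. (K i j * w j) * (x j / w j) powr p)"
      by (intro mult_right_mono powr_mono2 row sum_nonneg mult_nonneg_nonneg)
         (use fin p K[OF i] x w i in \<open>auto intro!: mult_nonneg_nonneg sum_nonneg simp: less_imp_le\<close>)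
    also have "\<dots> = R powr (p - 1) * (\<Sum>j\<in>J. K i j * h i powr (p - 1) * (x j powr p * w j powr (1 - p)))"
    proof -
      have "(K i j * w j) * (x j / w j) powr p = K i j * (x j powr p * w j powr (1 - p))" if "j \<in> J" for j
        using w[OF that] x[OF that] by (simp add: powr_divide powr_diff)
      then have "(\<Sum>j\<in>J. (K i j * w j) * (x j / w j) powr p) = (\<Sum>j\<in>J. K i j * (x j powr p * w j powr (1 - p)))"
        by (rule sum.cong[OF refl])
      then show ?thesis
        using R h[OF i] by (simp add: powr_mult sum_distrib_left mult_ac less_imp_le)
    qed
    finally show ?thesis .
  qed
  then have "(\<Sum>i\<in>I. (\<Sum>j\<in>J. K i j * x j) powr p)
      \<le> (\<Sum>i\<in>I. R powr (p - 1) * (\<Sum>j\<in>J. K i j * h i powr (p - 1) * (x j powr p * w j powr (1 - p))))"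
    by (rule sum_mono)
  also have "\<dots> = R powr (p - 1) * (\<Sum>j\<in>J. (\<Sum>i\<in>I. K i j * h i powr (p - 1)) * (x j powr p * w j powr (1 - p)))"
    by (simp add: sum_distrib_left[symmetric] sum_distrib_right sum.swap[of _ I J])
  also have "\<dots> \<le> R powr (p - 1) * (\<Sum>j\<in>J. (S * w j powr (p - 1)) * (x j powr p * w j powr (1 - p)))"
    by (intro mult_left_mono sum_mono mult_right_mono col mult_nonneg_nonneg) auto
  also have "(\<Sum>j\<in>J. (S * w j powr (p - 1)) * (x j powr p * w j powr (1 - p))) = (\<Sum>j\<in>J. S * x j powr p)"
  proof (intro sum.cong refl)
    fix j assume "j \<in> J"
    then have "w j > 0" by (rule w)
    then have "w j powr (p - 1) * w j powr (1 - p) = 1" by (simp add: powr_add[symmetric])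
    then show "(S * w j powr (p - 1)) * (x j powr p * w j powr (1 - p)) = S * x j powr p"
      by (metis (no_types, lifting) mult.assoc mult.commute mult.right_neutral)
  qed
  finally show ?thesis by (simp add: sum_distrib_left mult_ac)
qed

lemma sum_powr_le:
  fixes x :: "'a \<Rightarrow> real"
  assumes "finite J" "1 < p" "\<And>j. j \<in> J \<Longrightarrow> 0 \<le> x j"
  shows "(\<Sum>j\<in>J. x j) powr p \<le> real (card J) powr (p - 1) * (\<Sum>j\<in>J. x j powr p)"
  using weighted_power_mean[of J p "\<lambda>_. 1" x] assms by simp

lemma add_powr_le:
  fixes x y :: real
  assumes "1 < p" "0 \<le> x" "0 \<le> y"
  shows "(x + y) powr p \<le> 2 powr (p - 1) * (x powr p + y powr p)"
  using sum_powr_le[of "{True, False}" p "\<lambda>b. if b then x else y"] assms by simp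

section \<open>Power sums compared with integrals\<close>

lemma powr_Suc_diff:
  fixes e :: real and n :: nat
  assumes "n \<noteq> 0"
  obtains \<xi> where "real n < \<xi>" "\<xi> < real n + 1" "(real n + 1) powr e - real n powr e = e * \<xi> powr (e - 1)"
proof -
  have "\<exists>z. real n < z \<and> z < real n + 1 \<and>
      (real n + 1) powr e - real n powr e = (real n + 1 - real n) * (e * z powr (e - 1))"
    by (rule MVT2) (use assms in \<open>auto intro!: derivative_eq_intros\<close>)
  then show ?thesis using that by auto
qed

lemma sum_powr_minus_le:
  fixes r :: real
  assumes "0 \<le> r" "r < 1"
  shows "(\<Sum>i<n. (real i + 1) powr - r) \<le> real n powr (1 - r) / (1 - r)"
proof (induction n)
  case (Suc n)
  have "(real n + 1) powr - r \<le> ((real n + 1) powr (1 - r) - real n powr (1 - r)) / (1 - r)"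
  proof (cases "n = 0")
    case False
    then obtain \<xi> where \<xi>: "real n < \<xi>" "\<xi> < real n + 1"
      "(real n + 1) powr (1 - r) - real n powr (1 - r) = (1 - r) * \<xi> powr (1 - r - 1)"
      by (rule powr_Suc_diff)
    have "(real n + 1) powr - r \<le> \<xi> powr - r"
      by (rule powr_mono2') (use \<xi> assms False in auto)
    then show ?thesis using \<xi> assms by simp
  qed (use assms in simp)
  with Suc show ?case by (simp add: add_divide_distrib diff_divide_distrib add.commute)
qed simp

lemma sum_powr_ge:
  fixes q :: real
  assumes "0 \<le> q"
  shows "real n powr (1 + q) / (1 + q) \<le> (\<Sum>i<n. (real i + 1) powr q)"
proof (induction n)
  case (Suc n)
  have "((real n + 1) powr (1 + q) - real n powr (1 + q)) / (1 + q) \<le> (real n + 1) powr q"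
  proof (cases "n = 0")
    case False
    then obtain \<xi> where \<xi>: "real n < \<xi>" "\<xi> < real n + 1"
      "(real n + 1) powr (1 + q) - real n powr (1 + q) = (1 + q) * \<xi> powr (1 + q - 1)"
      by (rule powr_Suc_diff)
    have "\<xi> powr q \<le> (real n + 1) powr q"
      by (rule powr_mono2) (use \<xi> assms False in auto)
    then show ?thesis using \<xi> assms by simp
  qed (use assms in simp)
  with Suc show ?case by (simp add: diff_divide_distrib add.commute)
qed simp

lemma sum_powr_tail_le:
  fixes r :: real
  assumes "0 < r"
  shows "(\<Sum>i\<in>{m..<n}. (real i + 1) powr (- 1 - r)) \<le> (1 + 1 / r) * (real m + 1) powr - r"
proof (cases "m < n")
  case True
  \<comment> \<open>The subtracted term makes the bound inductive: at \<open>n = m + 1\<close> the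
    right side is \<open>(m + 1) powr - r\<close>, which pays for the first summand, and every later
    summand is at most the decrease of \<open>n powr - r / r\<close>.\<close>
  then have "(\<Sum>i\<in>{m..<n}. (real i + 1) powr (- 1 - r)) \<le> (1 + 1 / r) * (real m + 1) powr - r - real n powr - r / r"
  proof (induction n)
    case 0
    then show ?case by simp
  next
    case (Suc n)
    show ?case
    proof (cases "m < n")
      case False
      then have "n = m" using Suc.prems by simp
      moreover have "(real m + 1) powr (- 1 - r) \<le> (real m + 1) powr - r"
        by (intro powr_mono) auto
      ultimately show ?thesis by (simp add: algebra_simps)
    next
      case True
      then obtain \<xi> where \<xi>: "real n < \<xi>" "\<xi> < real n + 1"
        "(real n + 1) powr - r - real n powr - r = - r * \<xi> powr (- r - 1)"
        using powr_Suc_diff[of n "- r"] by (metis not_less0)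
      have "(real n + 1) powr (- 1 - r) \<le> \<xi> powr (- 1 - r)"
        by (rule powr_mono2') (use \<xi> assms True in auto)
      also have "\<dots> = (real n powr - r - (real n + 1) powr - r) / r"
        using \<xi>(3) assms by (simp add: field_simps minus_diff_commute)
      finally have *: "(real n + 1) powr (- 1 - r) \<le> (real n powr - r - (real n + 1) powr - r) / r" .
      with Suc.IH[OF True] True show ?thesis by (simp add: diff_divide_distrib add.commute)
    qed
  qed
  also have "\<dots> \<le> (1 + 1 / r) * (real m + 1) powr - r" using assms by simp
  finally show ?thesis .
qed (use assms in simp)

text \<open>Powers are approximate eigenvectors of Hilbert's matrix. Up to \<open>v = u\<close> the
  denominator is at least \<open>u + 1\<close>, and a power sum contributes
  \<open>1 / (1 - r)\<close>; beyond, it is at least \<open>v + 1\<close>, and a tail sum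
  contributes \<open>1 + 1 / r\<close>.\<close>

lemma hilbert_row_sum:
  fixes r :: real
  assumes "0 < r" "r < 1"
  shows "(\<Sum>v<n. (real v + 1) powr - r / (real u + real v + 1))
    \<le> (1 / (1 - r) + 1 + 1 / r) * (real u + 1) powr - r"
proof -
  have "(\<Sum>v<n. (real v + 1) powr - r / (real u + real v + 1))
     \<le> (\<Sum>v\<in>{..<u+1} \<union> {u+1..<n}. (real v + 1) powr - r / (real u + real v + 1))"
    by (intro sum_mono2) (auto intro!: divide_nonneg_nonneg)
  also have "\<dots> = (\<Sum>v<u+1. (real v + 1) powr - r / (real u + real v + 1))
      + (\<Sum>v\<in>{u+1..<n}. (real v + 1) powr - r / (real u + real v + 1))"
    by (intro sum.union_disjoint) auto
  also have "(\<Sum>v<u+1. (real v + 1) powr - r / (real u + real v + 1))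
      \<le> (\<Sum>v<u+1. (real v + 1) powr - r / (real u + 1))"
    by (intro sum_mono divide_left_mono) auto
  also have "\<dots> = (\<Sum>v<u+1. (real v + 1) powr - r) / (real u + 1)"
    by (rule sum_divide_distrib[symmetric])
  also have "\<dots> \<le> real (u + 1) powr (1 - r) / (1 - r) / (real u + 1)"
    by (intro divide_right_mono sum_powr_minus_le) (use assms in auto)
  also have "\<dots> = 1 / (1 - r) * (real u + 1) powr - r"
  proof -
    have "(1 + real u) powr (1 - r) = (1 + real u) * (1 + real u) powr - r"
      using powr_add[of "1 + real u" 1 "- r"] by simp
    then show ?thesis by (simp add: add.commute)
  qed
  also have "(\<Sum>v\<in>{u+1..<n}. (real v + 1) powr - r / (real u + real v + 1))
     \<le> (\<Sum>v\<in>{u+1..<n}. (real v + 1) powr (- 1 - r))"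
  proof (intro sum_mono)
    fix v
    have "(real v + 1) powr - r / (real u + real v + 1) \<le> (real v + 1) powr - r / (real v + 1)"
      by (intro divide_left_mono) auto
    also have "\<dots> = (real v + 1) powr (- 1 - r)"
      using powr_add[of "real v + 1" "- 1" "- r"] by (simp add: powr_minus_divide)
    finally show "(real v + 1) powr - r / (real u + real v + 1) \<le> (real v + 1) powr (- 1 - r)" .
  qed
  also have "\<dots> \<le> (1 + 1 / r) * (real (u + 1) + 1) powr - r"
    by (rule sum_powr_tail_le) fact
  also have "\<dots> \<le> (1 + 1 / r) * (real u + 1) powr - r"
    by (intro mult_left_mono powr_mono2') (use assms in auto)
  finally show ?thesis by (simp add: algebra_simps)
qed

subsection \<open>Cesaro coefficients\<close>

definition cesaro :: "real \<Rightarrow> nat \<Rightarrow> real" where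
  "cesaro a n = pochhammer a n / fact n"

lemma cesaro_0 [simp]: "cesaro a 0 = 1"
  by (simp add: cesaro_def)

lemma cesaro_zero: "cesaro 0 n = (if n = 0 then 1 else 0)"
  by (simp add: cesaro_def pochhammer_0_left)

lemma cesaro_one [simp]: "cesaro 1 n = 1"
  by (simp add: cesaro_def pochhammer_fact[symmetric])

lemma cesaro_Suc: "cesaro a (Suc n) = cesaro a n * (a + n) / (n + 1)"
  by (simp add: cesaro_def pochhammer_Suc field_simps)

text \<open>For \<open>a > - 1\<close> the factor \<open>cesaro (1 + a) n\<close> is positive, so
  every coefficient after the first has the sign of \<open>a\<close>, and its size is reduced to
  that of a positive parameter.\<close>

lemma cesaro_Suc': "cesaro a (Suc n) = a * cesaro (1 + a) n / (n + 1)"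
  by (simp add: cesaro_def pochhammer_rec field_simps)

lemma cesaro_pos: "0 < a \<Longrightarrow> 0 < cesaro a n"
  by (simp add: cesaro_def pochhammer_pos)

lemma cesaro_nonneg: "0 \<le> a \<Longrightarrow> 0 \<le> cesaro a n"
  by (cases "a = 0") (auto simp: cesaro_zero cesaro_pos less_imp_le)

text \<open>Vandermonde's identity for rising factorials, that is, the Cauchy product of two
  binomial series.\<close>

lemma cesaro_add: "cesaro (a + b) n = (\<Sum>k\<le>n. cesaro a k * cesaro b (n - k))"
proof -
  have "real (n choose k) / fact n = 1 / (fact k * fact (n - k))" if "k \<le> n" for k
    using that by (simp add: binomial_fact)
  then show ?thesis
    unfolding cesaro_def pochhammer_binomial_sum sum_divide_distrib
    by (intro sum.cong) (auto simp: field_simps)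
qed

lemma sum_cesaro: "(\<Sum>k\<le>n. cesaro a k) = cesaro (1 + a) n"
  using cesaro_add[of a 1 n] by (simp add: add.commute)

text \<open>Discrete form of \<open>\<integral> (u - s) powr (a - 1) * (v + s) powr (- a - 1) ds = u powr a * v powr - a / (a * (u + v))\<close>
  over \<open>0 < s < u\<close>.\<close>

lemma cesaro_corner:
  "(\<Sum>i\<le>u. cesaro a (u - i) * cesaro (- a) (Suc (v + i)))
     = - a * cesaro (1 + a) u * cesaro (1 - a) v / (real u + real v + 1)"
proof (induction u arbitrary: v)
  case 0
  show ?case by (simp add: cesaro_Suc' add.commute)
next
  case (Suc u)
  \<comment> \<open>Splitting off \<open>i = 0\<close> leaves the same sum for \<open>u\<close> and
    \<open>Suc v\<close>, which is why \<open>v\<close> varies in the induction.\<close>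
  have "(\<Sum>i\<le>Suc u. cesaro a (Suc u - i) * cesaro (- a) (Suc (v + i)))
      = cesaro a (Suc u) * cesaro (- a) (Suc v) + (\<Sum>i\<le>u. cesaro a (u - i) * cesaro (- a) (Suc (Suc v + i)))"
    by (subst sum.atMost_Suc_shift) simp
  also have "\<dots> = a * cesaro (1 + a) u / (u + 1) * (- a * cesaro (1 - a) v / (v + 1))
      + - a * cesaro (1 + a) u * (cesaro (1 - a) v * (1 - a + v) / (v + 1)) / (real u + real (Suc v) + 1)"
    unfolding Suc.IH by (simp add: cesaro_Suc'[of a u] cesaro_Suc'[of "- a" v] cesaro_Suc[of "1 - a" v])
  also have "\<dots> = - a * cesaro (1 + a) u * cesaro (1 - a) v *
      (a / ((real u + 1) * (real v + 1)) + (1 - a + v) / ((real v + 1) * (real u + real v + 2)))"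
    by (simp add: algebra_simps)
  also have "a / ((real u + 1) * (real v + 1)) + (1 - a + v) / ((real v + 1) * (real u + real v + 2))
      = (1 + a + u) / ((real u + 1) * (real u + real v + 2))"
  proof -
    have "real u + 1 \<noteq> 0" "real v + 1 \<noteq> 0" "real u + real v + 2 \<noteq> 0" by linarith+
    then show ?thesis
      by (simp add: divide_simps) (simp add: algebra_simps)
  qed
  also have "- a * cesaro (1 + a) u * cesaro (1 - a) v * ((1 + a + u) / ((real u + 1) * (real u + real v + 2)))
      = - a * cesaro (1 + a) (Suc u) * cesaro (1 - a) v / (real (Suc u) + real v + 1)"
    by (simp add: cesaro_Suc[of "1 + a" u] algebra_simps)
  finally show ?case .
qed

text \<open>The quotient of the two sides converges to \<open>1 / Gamma (1 + c)\<close> by Euler's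
  limit formula. Its terms and its limit are positive, so both the quotient and its inverse are
  bounded sequences.\<close>

lemma cesaro_growth:
  assumes "-1 < c"
  obtains C C' where "0 < C" "0 < C'" "\<And>n. C * (real n + 1) powr c \<le> cesaro (1 + c) n"
    "\<And>n. cesaro (1 + c) n \<le> C' * (real n + 1) powr c"
proof -
  define d where "d n = cesaro (1 + c) n / (real n + 1) powr c" for n
  have pos: "d n > 0" for n using assms by (simp add: d_def cesaro_pos)
  have G: "Gamma (1 + c) > 0" using assms by (simp add: Gamma_real_pos)
  have "(\<lambda>n. real n / (real n + 1)) \<longlonglongrightarrow> 1"
    using LIMSEQ_n_over_Suc_n by (simp add: add.commute)
  then have "(\<lambda>n. (real n / (real n + 1)) powr c / Gamma_series' (1 + c) n) \<longlonglongrightarrow> 1 powr c / Gamma (1 + c)"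
    by (intro tendsto_intros Gamma_series'_LIMSEQ) (use G in auto)
  moreover have "eventually (\<lambda>n. (real n / (real n + 1)) powr c / Gamma_series' (1 + c) n = d n) sequentially"
    using eventually_gt_at_top[of 0]
  proof eventually_elim
    case (elim n)
    then obtain m where m: "n = Suc m" by (cases n) auto
    have "exp ((1 + c) * ln (real n)) = real n * real n powr c"
      using elim by (simp add: powr_def ring_distribs exp_add)
    moreover have "fact n = real n * fact (n - 1)" using m by simp
    ultimately show ?case using elim
      by (simp add: d_def cesaro_def Gamma_series'_def powr_divide)
  qed
  ultimately have d: "d \<longlonglongrightarrow> 1 powr c / Gamma (1 + c)"
    by (rule Lim_transform_eventually)
  then have "Bseq d" by (rule convergentI[THEN convergent_imp_Bseq])
  then obtain C' where C': "C' > 0" "\<And>n. norm (d n) \<le> C'" by (rule BseqE) auto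
  have "Bseq (\<lambda>n. inverse (d n))"
    by (rule convergentI[THEN convergent_imp_Bseq], rule tendsto_inverse[OF d]) (use G in auto)
  then obtain B where B: "B > 0" "\<And>n. norm (inverse (d n)) \<le> B" by (rule BseqE) auto
  show ?thesis
  proof (rule that[of "inverse B" C'])
    fix n
    have "inverse B \<le> d n"
      using B(1) B(2)[of n] pos[of n] by (simp add: field_simps)
    then show "inverse B * (real n + 1) powr c \<le> cesaro (1 + c) n"
      by (simp add: d_def field_simps add_pos_nonneg)
    have "d n \<le> C'" using C'(2)[of n] by simp
    then show "cesaro (1 + c) n \<le> C' * (real n + 1) powr c"
      by (simp add: d_def field_simps add_pos_nonneg)
  qed (use B C' in auto)
qed

lemma abs_cesaro_le:
  assumes "-1 < a" "a \<le> 1"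
  obtains C where "0 < C" "\<And>n. \<bar>cesaro a n\<bar> \<le> C * (real n + 1) powr (a - 1)"
proof -
  obtain C C' where C: "0 < C'" "\<And>n. cesaro (1 + a) n \<le> C' * (real n + 1) powr a"
    using cesaro_growth[OF assms(1)] by metis
  show ?thesis
  \<comment> \<open>The summand 1 covers \<open>n = 0\<close>. For \<open>n = m + 1\<close> the base
    \<open>m + 1\<close> is replaced by \<open>(n + 1) / 2\<close>, which costs
    \<open>2 powr (1 - a)\<close>, at most 4.\<close>
  proof (rule that[of "1 + 4 * C'"])
    fix n
    show "\<bar>cesaro a n\<bar> \<le> (1 + 4 * C') * (real n + 1) powr (a - 1)"
    proof (cases n)
      case (Suc m)
      have a: "cesaro (1 + a) m \<ge> 0" using assms by (intro cesaro_nonneg) auto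
      have "\<bar>cesaro a n\<bar> = \<bar>a\<bar> * cesaro (1 + a) m / (real m + 1)"
        using a by (simp add: Suc cesaro_Suc' abs_mult)
      also have "\<dots> \<le> 1 * (C' * (real m + 1) powr a) / (real m + 1)"
        by (intro divide_right_mono mult_mono C) (use assms a C in auto)
      also have "\<dots> = C' * (real m + 1) powr (a - 1)" by (simp add: powr_diff)
      also have "(real m + 1) powr (a - 1) \<le> ((real m + 2) / 2) powr (a - 1)"
        by (rule powr_mono2') (use assms in auto)
      also have "((real m + 2) / 2) powr (a - 1) = (real n + 1) powr (a - 1) * 2 powr (1 - a)"
        by (simp add: Suc powr_divide powr_diff add.commute)
      also have "2 powr (1 - a) \<le> 2 powr 2" using assms by (intro powr_mono) auto
      also have "C' * ((real n + 1) powr (a - 1) * 2 powr 2) = 4 * C' * (real n + 1) powr (a - 1)"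
        by simp
      also have "\<dots> \<le> (1 + 4 * C') * (real n + 1) powr (a - 1)"
        by (intro mult_right_mono) auto
      finally show ?thesis using C by simp
    qed (use C in auto)
  qed (use C in auto)
qed

text \<open>All coefficients of \<open>(1 - z) powr a\<close> except the leading 1 are nonpositive
  and the partial sums stay nonnegative, so the negative part has total at most 1.\<close>

lemma sum_abs_cesaro_le:
  assumes "0 \<le> a" "a \<le> 1"
  shows "(\<Sum>d<n. \<bar>cesaro (- a) d\<bar>) \<le> 2"
proof (cases n)
  case (Suc m)
  have "\<bar>cesaro (- a) (Suc d)\<bar> = - cesaro (- a) (Suc d)" for d
    using assms cesaro_nonneg[of "1 - a" d] by (simp add: cesaro_Suc' abs_mult)
  then have "(\<Sum>d<n. \<bar>cesaro (- a) d\<bar>) = 1 - (\<Sum>d<m. cesaro (- a) (Suc d))"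
    unfolding Suc by (subst sum.lessThan_Suc_shift) (simp add: sum_negf)
  also have "(\<Sum>d<m. cesaro (- a) (Suc d)) = cesaro (1 - a) m - 1"
    using sum_cesaro[of "- a" m] unfolding lessThan_Suc_atMost[symmetric]
    by (subst (asm) sum.lessThan_Suc_shift) simp
  finally show ?thesis using cesaro_nonneg[of "1 - a" m] assms by simp
qed simp

text \<open>For \<open>\<bar>a\<bar> < 1\<close> this is the absolute value of the closed form in
  \<open>cesaro_corner\<close>. Here \<open>u\<close> counts rows forward from the cut at
  \<open>N\<close>, and \<open>v\<close> counts columns backward from \<open>N - 1\<close>.\<close>

definition corner :: "real \<Rightarrow> nat \<Rightarrow> nat \<Rightarrow> real" where
  "corner a u v = \<bar>a\<bar> * cesaro (1 + a) u * cesaro (1 - a) v / (real u + real v + 1)"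

lemma corner_nonneg: "\<bar>a\<bar> < 1 \<Longrightarrow> 0 \<le> corner a u v"
  by (auto simp: corner_def intro!: mult_nonneg_nonneg divide_nonneg_nonneg cesaro_nonneg)

lemma corner_le:
  assumes "\<bar>a\<bar> < 1"
  obtains C where "0 < C"
    "\<And>u v. corner a u v \<le> C * ((real u + 1) powr a * (real v + 1) powr - a / (real u + real v + 1))"
proof -
  obtain C where C: "0 < C" "\<And>n. cesaro (1 + a) n \<le> C * (real n + 1) powr a"
    using cesaro_growth[of a] assms by (metis abs_less_iff minus_less_iff)
  obtain D where D: "0 < D" "\<And>n. cesaro (1 + - a) n \<le> D * (real n + 1) powr - a"
    using cesaro_growth[of "- a"] assms by (metis abs_less_iff neg_less_iff_less)
  show ?thesis
  proof (rule that[of "C * D"])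
    fix u v
    have "corner a u v \<le> 1 * (C * (real u + 1) powr a) * (D * (real v + 1) powr - a) / (real u + real v + 1)"
      unfolding corner_def
      by (intro divide_right_mono mult_mono C D[simplified]) (use assms C D in \<open>auto intro!: cesaro_nonneg mult_nonneg_nonneg\<close>)
    then show "corner a u v \<le> C * D * ((real u + 1) powr a * (real v + 1) powr - a / (real u + real v + 1))"
      by (simp add: mult_ac)
  qed (use C D in auto)
qed

lemma corner_bounded:
  assumes p: "1 < p" and a: "- 1 / p < a" "a < 1 - 1 / p"
  obtains C where "0 < C"
    "\<And>m n y. (\<And>v. v < n \<Longrightarrow> 0 \<le> y v) \<Longrightarrow>
       (\<Sum>u<m. (\<Sum>v<n. corner a u v * y v) powr p) \<le> C * (\<Sum>v<n. y v powr p)"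
proof -
  have p1: "1 / p < 1" "0 < 1 / p" using p by simp_all
  have a1: "\<bar>a\<bar> < 1" using a p1 unfolding abs_less_iff by linarith
  obtain C where C: "0 < C"
    "\<And>u v. corner a u v \<le> C * ((real u + 1) powr a * (real v + 1) powr - a / (real u + real v + 1))"
    using corner_le[OF a1] by metis
  \<comment> \<open>The Schur test is run with the weight \<open>(v + 1) powr - s\<close>. Rows
    require \<open>0 < a + s < 1\<close>, columns \<open>0 < s * (p - 1) - a < 1\<close>. The first
    two inequalities, which together with two trivial ones make room for \<open>s\<close>, are the
    two hypotheses on \<open>a\<close> rewritten.\<close>
  have "- a < (1 + a) / (p - 1)" "a / (p - 1) < 1 - a" "a / (p - 1) < (1 + a) / (p - 1)"
    using a p by (simp_all add: field_simps)
  then have "max (- a) (a / (p - 1)) < min (1 - a) ((1 + a) / (p - 1))"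
    by simp
  then obtain s where s: "max (- a) (a / (p - 1)) < s" "s < min (1 - a) ((1 + a) / (p - 1))"
    using dense by blast
  define r where "r = a + s"
  define q where "q = s * (p - 1) - a"
  have r: "0 < r" "r < 1" using s by (auto simp: r_def)
  have q: "0 < q" "q < 1" using s p by (auto simp: q_def field_simps)
  define R where "R = 1 / (1 - r) + 1 + 1 / r"
  define Q where "Q = 1 / (1 - q) + 1 + 1 / q"
  have R: "R > 0" using r by (simp add: R_def add_pos_pos)
  have Q: "Q > 0" using q by (simp add: Q_def add_pos_pos)
  show ?thesis
  proof (rule that[of "(C * R) powr (p - 1) * (C * Q)"])
    fix m n :: nat and y :: "nat \<Rightarrow> real"
    assume y: "\<And>v. v < n \<Longrightarrow> 0 \<le> y v"
    show "(\<Sum>u<m. (\<Sum>v<n. corner a u v * y v) powr p) \<le> (C * R) powr (p - 1) * (C * Q) * (\<Sum>v<n. y v powr p)"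
    proof (rule schur_test[where h = "\<lambda>u. (real u + 1) powr - s" and w = "\<lambda>v. (real v + 1) powr - s"])
      fix u
      have "(\<Sum>v<n. corner a u v * (real v + 1) powr - s)
         \<le> (\<Sum>v<n. C * ((real u + 1) powr a * (real v + 1) powr - a / (real u + real v + 1)) * (real v + 1) powr - s)"
        by (intro sum_mono mult_right_mono C) auto
      also have "\<dots> = C * (real u + 1) powr a * (\<Sum>v<n. (real v + 1) powr - r / (real u + real v + 1))"
        by (simp add: sum_distrib_left r_def powr_diff powr_minus field_simps powr_add)
      also have "\<dots> \<le> C * (real u + 1) powr a * (R * (real u + 1) powr - r)"
        unfolding R_def by (intro mult_left_mono hilbert_row_sum r) (use C in auto)
      also have "\<dots> = C * R * (real u + 1) powr - s"
        by (simp add: r_def powr_add[symmetric])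
      finally show "(\<Sum>v<n. corner a u v * (real v + 1) powr - s) \<le> C * R * (real u + 1) powr - s" .
    next
      fix v
      have "(\<Sum>u<m. corner a u v * ((real u + 1) powr - s) powr (p - 1))
         \<le> (\<Sum>u<m. C * ((real u + 1) powr a * (real v + 1) powr - a / (real u + real v + 1)) * ((real u + 1) powr - s) powr (p - 1))"
        by (intro sum_mono mult_right_mono C) auto
      also have "\<dots> = C * (real v + 1) powr - a * (\<Sum>u<m. (real u + 1) powr - q / (real v + real u + 1))"
      proof -
        have *: "(real u + 1) powr a * ((real u + 1) powr - s) powr (p - 1) = (real u + 1) powr - q" for u :: nat
          by (simp add: q_def powr_powr powr_add[symmetric])
        show ?thesis
          unfolding sum_distrib_left
          by (intro sum.cong refl, subst *[symmetric]) (simp add: mult_ac add_ac)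
      qed
      also have "\<dots> \<le> C * (real v + 1) powr - a * (Q * (real v + 1) powr - q)"
        unfolding Q_def by (intro mult_left_mono hilbert_row_sum q) (use C in auto)
      also have "\<dots> = C * Q * ((real v + 1) powr - s) powr (p - 1)"
        by (simp add: q_def powr_powr powr_add[symmetric])
      finally show "(\<Sum>u<m. corner a u v * ((real u + 1) powr - s) powr (p - 1))
        \<le> C * Q * ((real v + 1) powr - s) powr (p - 1)" .
    qed (use p y C R a1 in \<open>auto intro: corner_nonneg\<close>)
  qed (use C R Q in auto)
qed

text \<open>Boundedness of the corner does not yet give convergence of partial sums. A fixed entry
  of the input lies in a column that moves away from the cut as \<open>N\<close> grows, so its
  contribution vanishes once column norms decay in \<open>v\<close>.\<close>

lemma corner_column_decay:
  assumes p: "1 < p" and a: "- 1 / p < a" "a < 1 - 1 / p"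
  obtains C \<delta> where "0 < C" "0 < \<delta>"
    "\<And>m v. (\<Sum>u<m. corner a u v powr p) \<le> C * (real v + 1) powr - \<delta>"
proof -
  have p1: "1 / p < 1" "0 < 1 / p" using p by simp_all
  have a1: "\<bar>a\<bar> < 1" using a p1 unfolding abs_less_iff by linarith
  obtain C where C: "0 < C"
    "\<And>u v. corner a u v \<le> C * ((real u + 1) powr a * (real v + 1) powr - a / (real u + real v + 1))"
    using corner_le[OF a1] by metis
  \<comment> \<open>The denominator is at least
    \<open>(u + 1) powr \<theta> * (v + 1) powr (1 - \<theta>)\<close>. Summability over
    \<open>u\<close> requires \<open>(\<theta> - a) * p > 1\<close>, decay in \<open>v\<close>
    requires \<open>\<theta> < 1 + a\<close>.\<close>
  have "a + 1 / p < min 1 (1 + a)"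
    using a p1 by auto
  then obtain \<theta> where \<theta>: "a + 1 / p < \<theta>" "\<theta> < min 1 (1 + a)"
    using dense by blast
  have \<theta>0: "0 < \<theta>" "\<theta> < 1" using a \<theta> by auto
  define r where "r = (\<theta> - a) * p - 1"
  define \<delta> where "\<delta> = (1 + a - \<theta>) * p"
  have r: "r > 0" using \<theta> p by (simp add: r_def field_simps)
  have \<delta>: "\<delta> > 0" using \<theta> p by (simp add: \<delta>_def)
  show ?thesis
  proof (rule that[of "C powr p * (1 + 1 / r)" \<delta>])
    fix m v :: nat
    have "corner a u v powr p \<le> C powr p * (real v + 1) powr - \<delta> * (real u + 1) powr (- 1 - r)" for u
    proof -
      have "(real u + 1) powr \<theta> * (real v + 1) powr (1 - \<theta>)
          \<le> (real u + real v + 1) powr \<theta> * (real u + real v + 1) powr (1 - \<theta>)"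
        by (intro mult_mono powr_mono2) (use \<theta>0 in auto)
      also have "\<dots> = real u + real v + 1" by (simp add: powr_add[symmetric])
      finally have "corner a u v \<le> C * ((real u + 1) powr a * (real v + 1) powr - a /
          ((real u + 1) powr \<theta> * (real v + 1) powr (1 - \<theta>)))"
        by (intro order_trans[OF C(2)] mult_left_mono divide_left_mono) (use C in auto)
      also have "\<dots> = C * ((real u + 1) powr (a - \<theta>) * (real v + 1) powr (- a - (1 - \<theta>)))"
        by (simp only: powr_diff times_divide_times_eq)
      finally have "corner a u v powr p \<le> (C * ((real u + 1) powr (a - \<theta>) * (real v + 1) powr (- a - (1 - \<theta>)))) powr p"
        by (intro powr_mono2) (use corner_nonneg[OF a1] p in auto)
      also have "\<dots> = C powr p * ((real u + 1) powr ((a - \<theta>) * p) * (real v + 1) powr ((- a - (1 - \<theta>)) * p))"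
        using C by (simp add: powr_mult powr_powr)
      also have "(a - \<theta>) * p = - 1 - r" by (simp add: r_def algebra_simps)
      also have "(- a - (1 - \<theta>)) * p = - \<delta>" by (simp add: \<delta>_def algebra_simps)
      finally show ?thesis by (simp add: mult_ac)
    qed
    then have "(\<Sum>u<m. corner a u v powr p) \<le> (\<Sum>u<m. C powr p * (real v + 1) powr - \<delta> * (real u + 1) powr (- 1 - r))"
      by (rule sum_mono)
    also have "\<dots> = C powr p * (real v + 1) powr - \<delta> * (\<Sum>u\<in>{0..<m}. (real u + 1) powr (- 1 - r))"
      by (simp add: sum_distrib_left atLeast0LessThan)
    also have "\<dots> \<le> C powr p * (real v + 1) powr - \<delta> * ((1 + 1 / r) * (real 0 + 1) powr - r)"
      by (intro mult_left_mono sum_powr_tail_le r) auto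
    finally show "(\<Sum>u<m. corner a u v powr p) \<le> C powr p * (1 + 1 / r) * (real v + 1) powr - \<delta>"
      by (simp add: mult_ac)
  qed (use C r \<delta> in \<open>auto intro!: mult_pos_pos add_pos_pos\<close>)
qed

subsection \<open>Cesaro convolution\<close>

definition cesaro_op :: "real \<Rightarrow> (nat \<Rightarrow> 'k::real_normed_field) \<Rightarrow> nat \<Rightarrow> 'k" where
  "cesaro_op a f i = (\<Sum>j\<le>i. of_real (cesaro a (i - j)) * f j)"

lemma sum_triangle_swap:
  fixes g :: "nat \<Rightarrow> nat \<Rightarrow> 'a::comm_monoid_add"
  shows "(\<Sum>j\<le>i. \<Sum>k\<le>j. g j k) = (\<Sum>k\<le>i. \<Sum>l\<le>i - k. g (k + l) k)"
  unfolding sum.Sigma[OF finite_atMost ballI[OF finite_atMost]]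
  by (rule sum.reindex_bij_witness[where j = "\<lambda>(j, k). (k, j - k)" and i = "\<lambda>(k, l). (k + l, k)"]) auto

lemma cesaro_op_add: "cesaro_op a (cesaro_op b f) = cesaro_op (a + b) f"
proof
  fix i
  have "cesaro_op a (cesaro_op b f) i
      = (\<Sum>j\<le>i. \<Sum>k\<le>j. of_real (cesaro a (i - j)) * (of_real (cesaro b (j - k)) * f k))"
    by (simp add: cesaro_op_def sum_distrib_left)
  also have "\<dots> = (\<Sum>k\<le>i. of_real (\<Sum>l\<le>i - k. cesaro b l * cesaro a (i - k - l)) * f k)"
    by (simp add: sum_triangle_swap sum_distrib_left sum_distrib_right mult_ac)
  also have "\<dots> = (\<Sum>k\<le>i. of_real (cesaro (b + a) (i - k)) * f k)"
    by (simp only: cesaro_add[symmetric])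
  finally show "cesaro_op a (cesaro_op b f) i = cesaro_op (a + b) f i"
    by (simp add: cesaro_op_def add.commute)
qed

lemma cesaro_op_zero [simp]: "cesaro_op 0 f = f"
proof
  fix i
  have "cesaro_op 0 f i = (\<Sum>j\<le>i. if j = i then f j else 0)"
    unfolding cesaro_op_def by (intro sum.cong) (auto simp: cesaro_zero)
  then show "cesaro_op 0 f i = f i" by simp
qed

lemma cesaro_op_diff: "cesaro_op a (\<lambda>n. f n - g n) i = cesaro_op a f i - cesaro_op a g i"
  by (simp add: cesaro_op_def sum_subtractf right_diff_distrib)

lemma cesaro_op_plus: "cesaro_op a (\<lambda>n. f n + g n) i = cesaro_op a f i + cesaro_op a g i"
  by (simp add: cesaro_op_def sum.distrib distrib_left)

lemma cesaro_op_cong: "(\<And>n. n \<le> i \<Longrightarrow> f n = g n) \<Longrightarrow> cesaro_op a f i = cesaro_op a g i"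
  by (simp add: cesaro_op_def)

text \<open>The left side is the \<open>N\<close>-th partial sum of \<open>f\<close> along the
  vectors \<open>T\<^sub>a e\<^sub>n\<close>, whose coefficients are
  \<open>cesaro_op (- a) f\<close>. Below \<open>N\<close> the truncation is invisible because
  convolution only looks back; from \<open>N\<close> on, the corner appears.\<close>

lemma cesaro_op_truncate:
  "cesaro_op a (\<lambda>n. if n < N then cesaro_op (- a) f n else 0) i
    = (if i < N then f i else - (\<Sum>k<N. of_real (- a * cesaro (1 + a) (i - N) * cesaro (1 - a) (N - 1 - k) / (real (i - N) + real (N - 1 - k) + 1)) * f k))"
proof (cases "i < N")
  case True
  then have "cesaro_op a (\<lambda>n. if n < N then cesaro_op (- a) f n else 0) i = cesaro_op a (cesaro_op (- a) f) i"
    by (intro cesaro_op_cong) auto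
  then show ?thesis using True by (simp add: cesaro_op_add)
next
  case False
  \<comment> \<open>Truncating \<open>f\<close> itself does not change the coefficients below
    \<open>N\<close>. As \<open>cesaro_op a (cesaro_op (- a) h)\<close> is \<open>h\<close>, which
    vanishes from \<open>N\<close> on, the sum over the kept coefficients is minus the sum over the
    dropped ones, and the latter range \<open>N \<le> j \<le> i\<close> has the shape of
    \<open>cesaro_corner\<close>.\<close>
  define h where "h n = (if n < N then f n else 0)" for n
  define hc where "hc n = (if n < N then cesaro_op (- a) f n else 0)" for n
  have hc: "hc n = cesaro_op (- a) h n - (if N \<le> n then cesaro_op (- a) h n else 0)" for n
    by (auto simp: hc_def h_def intro!: cesaro_op_cong)
  have "cesaro_op a hc i = cesaro_op a (cesaro_op (- a) h) i
      - cesaro_op a (\<lambda>n. if N \<le> n then cesaro_op (- a) h n else 0) i"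
    unfolding cesaro_op_diff[symmetric] by (intro cesaro_op_cong hc)
  also have "cesaro_op a (cesaro_op (- a) h) i = 0"
    using False by (simp add: cesaro_op_add h_def)
  also have "cesaro_op a (\<lambda>n. if N \<le> n then cesaro_op (- a) h n else 0) i
      = (\<Sum>j\<in>{N..i}. of_real (cesaro a (i - j)) * cesaro_op (- a) h j)"
    unfolding cesaro_op_def[of a] by (rule sum.mono_neutral_cong_right) auto
  also have "\<dots> = (\<Sum>l\<le>i - N. of_real (cesaro a (i - N - l)) * cesaro_op (- a) h (N + l))"
    by (rule sum.reindex_bij_witness[where j = "\<lambda>j. j - N" and i = "\<lambda>l. N + l"]) (use False in auto)
  also have "\<dots> = (\<Sum>l\<le>i - N. of_real (cesaro a (i - N - l)) * (\<Sum>k<N. of_real (cesaro (- a) (N + l - k)) * f k))"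
  proof (intro sum.cong refl arg_cong2[where f = "(*)"])
    fix l
    show "cesaro_op (- a) h (N + l) = (\<Sum>k<N. of_real (cesaro (- a) (N + l - k)) * f k)"
      unfolding cesaro_op_def by (rule sum.mono_neutral_cong_right) (auto simp: h_def)
  qed
  also have "\<dots> = (\<Sum>k<N. of_real (\<Sum>l\<le>i - N. cesaro a (i - N - l) * cesaro (- a) (N + l - k)) * f k)"
    by (simp add: sum_distrib_left sum_distrib_right sum.swap[of _ "{..i - N}"] mult_ac)
  also have "\<dots> = (\<Sum>k<N. of_real (- a * cesaro (1 + a) (i - N) * cesaro (1 - a) (N - 1 - k) / (real (i - N) + real (N - 1 - k) + 1)) * f k)"
  proof (intro sum.cong refl arg_cong2[where f = "(*)"] arg_cong[where f = of_real])
    fix k assume "k \<in> {..<N}"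
    then have *: "N + l - k = Suc (N - 1 - k + l)" for l by auto
    show "(\<Sum>l\<le>i - N. cesaro a (i - N - l) * cesaro (- a) (N + l - k))
       = - a * cesaro (1 + a) (i - N) * cesaro (1 - a) (N - 1 - k) / (real (i - N) + real (N - 1 - k) + 1)"
      unfolding * by (rule cesaro_corner)
  qed
  finally show ?thesis using False unfolding hc_def by simp
qed

text \<open>Reading the input backward from the cut makes the kernel independent of
  \<open>N\<close>, so a single bound for \<open>corner\<close> serves all partial sums.\<close>

lemma norm_cesaro_op_truncate_le:
  fixes f :: "nat \<Rightarrow> 'k::real_normed_field"
  assumes "\<bar>a\<bar> < 1"
  shows "norm (cesaro_op a (\<lambda>n. if n < N then cesaro_op (- a) f n else 0) (N + u))
    \<le> (\<Sum>v<N. corner a u v * norm (f (N - 1 - v)))"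
proof -
  have c: "\<bar>- a * cesaro (1 + a) u * cesaro (1 - a) v / (real u + real v + 1)\<bar> = corner a u v" for v
    using assms cesaro_nonneg[of "1 + a" u] cesaro_nonneg[of "1 - a" v] by (simp add: corner_def abs_mult)
  have "norm (cesaro_op a (\<lambda>n. if n < N then cesaro_op (- a) f n else 0) (N + u))
      \<le> (\<Sum>k<N. norm (of_real (- a * cesaro (1 + a) u * cesaro (1 - a) (N - 1 - k) / (real u + real (N - 1 - k) + 1)) * f k))"
    unfolding cesaro_op_truncate by (simp add: sum_norm_le del: of_real_mult of_real_divide of_real_minus)
  also have "\<dots> = (\<Sum>k<N. corner a u (N - 1 - k) * norm (f k))"
    by (intro sum.cong refl) (simp only: norm_mult norm_of_real c)
  also have "\<dots> = (\<Sum>v<N. corner a u v * norm (f (N - 1 - v)))"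
    by (rule sum.reindex_bij_witness[where j = "\<lambda>k. N - 1 - k" and i = "\<lambda>k. N - 1 - k"]) auto
  finally show ?thesis .
qed

text \<open>The remainder consists of the tail of \<open>f\<close> and the corner applied to
  \<open>f\<close>. The entries from \<open>L\<close> on are small in norm and the corner is
  bounded; the first \<open>L\<close> entries meet only far columns, whose norms tend to zero.
  Finite sums with a bound uniform in \<open>M\<close> stand for the norm.\<close>

lemma cesaro_remainder_small:
  fixes f :: "nat \<Rightarrow> 'k::real_normed_field"
  assumes p: "1 < p" and a: "- 1 / p < a" "a < 1 - 1 / p" and f: "f \<in> lp_space p" and \<epsilon>: "0 < \<epsilon>"
  shows "\<forall>\<^sub>F N in sequentially. \<forall>M. (\<Sum>i<M. norm (f i - cesaro_op a (\<lambda>n. if n < N then cesaro_op (- a) f n else 0) i) powr p) \<le> \<epsilon>"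
proof -
  have p1: "1 / p < 1" "0 < 1 / p" using p by simp_all
  have a1: "\<bar>a\<bar> < 1" using a p1 unfolding abs_less_iff by linarith
  obtain C where C: "0 < C" "\<And>m n y. (\<And>v. v < n \<Longrightarrow> 0 \<le> y v) \<Longrightarrow>
       (\<Sum>u<m. (\<Sum>v<n. corner a u v * y v) powr p) \<le> C * (\<Sum>v<n. y v powr p)"
    using corner_bounded[OF p a] by blast
  obtain D \<delta> where D: "0 < D" "0 < \<delta>" "\<And>m v. (\<Sum>u<m. corner a u v powr p) \<le> D * (real v + 1) powr - \<delta>"
    using corner_column_decay[OF p a] by blast
  define c where "c = (2::real) powr (p - 1)"
  have c: "c \<ge> 1" using p by (simp add: c_def ge_one_powr_ge_zero)
  define x where "x k = norm (f k)" for k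
  \<comment> \<open>One share for the tail of \<open>f\<close>, \<open>C\<close> shares for the
    corner acting on that tail and one for the corner acting on the first \<open>L\<close> entries;
    each factor \<open>c\<close> pays for splitting the p-th power of a sum.\<close>
  define \<eta> where "\<eta> = \<epsilon> / (c * (1 + c * (C + 1)))"
  have pos: "c * (1 + c * (C + 1)) > 0" using c C by (intro mult_pos_pos add_pos_pos) auto
  have \<eta>: "\<eta> > 0" unfolding \<eta>_def using \<epsilon> pos by (intro divide_pos_pos)
  have "summable (\<lambda>k. x k powr p)" using f by (simp add: x_def lp_space_def)
  then obtain L where "\<And>m n. m \<ge> L \<Longrightarrow> norm (\<Sum>k=m..n. x k powr p) < \<eta>"
    using summable_partial_sum_bound \<eta> by metis
  then have tail': "(\<Sum>k=m..n. x k powr p) \<le> \<eta>" if "m \<ge> L" for m n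
    using that by (smt (verit, best) real_norm_def)
  have tail: "(\<Sum>k\<in>{m..<n}. x k powr p) \<le> \<eta>" if "m \<ge> L" for m n
    by (rule order_trans[OF sum_mono2 tail'[OF that, of n]]) auto
  have "(\<lambda>N. real L powr (p - 1) * (\<Sum>k<L. D * (real (N - (1 + k)) + 1) powr - \<delta> * x k powr p))
      \<longlonglongrightarrow> real L powr (p - 1) * (\<Sum>k<L. D * 0 * x k powr p)"
  proof (intro tendsto_intros)
    fix k
    have "filterlim (\<lambda>N. real (N - (1 + k)) + 1) at_top sequentially"
      by (rule filterlim_at_top_mono[OF filterlim_compose[OF filterlim_real_sequentially
            filterlim_minus_const_nat_at_top[of "1 + k"]] always_eventually]) auto
    then show "(\<lambda>N. (real (N - (1 + k)) + 1) powr - \<delta>) \<longlonglongrightarrow> 0"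
      using D(2) by (intro tendsto_neg_powr) auto
  qed
  then have "\<forall>\<^sub>F N in sequentially. real L powr (p - 1) * (\<Sum>k<L. D * (real (N - (1 + k)) + 1) powr - \<delta> * x k powr p) < \<eta>"
    using \<eta> by (intro order_tendstoD) auto
  then show ?thesis
    using eventually_ge_at_top[of L]
  proof eventually_elim
    case (elim N)
    define R where "R i = norm (f i - cesaro_op a (\<lambda>n. if n < N then cesaro_op (- a) f n else 0) i)" for i
    \<comment> \<open>In reversed order \<open>v < N - L\<close> means that the original index
      \<open>N - 1 - v\<close> is at least \<open>L\<close>: \<open>y\<close> carries the tail of
      the input, \<open>z\<close> its first \<open>L\<close> entries.\<close>
    define y where "y v = (if v < N - L then x (N - 1 - v) else 0)" for v
    define z where "z v = (if v < N - L then 0 else x (N - 1 - v))" for v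
    have R0: "R i = 0" if "i < N" for i using that by (simp add: R_def cesaro_op_truncate)
    have x0: "x k \<ge> 0" for k by (simp add: x_def)
    have K0: "corner a u v \<ge> 0" for u v by (rule corner_nonneg[OF a1])
    define Y where "Y u = (\<Sum>v<N. corner a u v * y v)" for u
    define Z where "Z u = (\<Sum>v<N. corner a u v * z v)" for u
    have Y0: "Y u \<ge> 0" for u unfolding Y_def by (intro sum_nonneg mult_nonneg_nonneg K0) (auto simp: y_def x0)
    have Z0: "Z u \<ge> 0" for u unfolding Z_def by (intro sum_nonneg mult_nonneg_nonneg K0) (auto simp: z_def x0)
    have R1: "R (N + u) powr p \<le> c * (x (N + u) powr p + c * (Y u powr p + Z u powr p))" for u
    proof -
      have "R (N + u) \<le> x (N + u) + (\<Sum>v<N. corner a u v * x (N - 1 - v))"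
        unfolding R_def x_def
        by (rule order_trans[OF norm_triangle_ineq4]) (intro add_left_mono norm_cesaro_op_truncate_le a1)
      also have "(\<Sum>v<N. corner a u v * x (N - 1 - v)) = Y u + Z u"
        unfolding Y_def Z_def sum.distrib[symmetric] by (intro sum.cong) (auto simp: y_def z_def)
      finally have "R (N + u) powr p \<le> (x (N + u) + (Y u + Z u)) powr p"
        by (intro powr_mono2) (use p in \<open>auto simp: R_def\<close>)
      also have "\<dots> \<le> c * (x (N + u) powr p + (Y u + Z u) powr p)"
        unfolding c_def by (intro add_powr_le) (use p x0 Y0 Z0 in auto)
      also have "(Y u + Z u) powr p \<le> c * (Y u powr p + Z u powr p)"
        unfolding c_def by (intro add_powr_le) (use p Y0 Z0 in auto)
      finally show ?thesis using c by simp
    qed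
    have SY: "(\<Sum>u<M. Y u powr p) \<le> C * \<eta>" for M
    proof -
      have "(\<Sum>u<M. Y u powr p) \<le> C * (\<Sum>v<N. y v powr p)"
        unfolding Y_def by (rule C(2)) (auto simp: y_def x0)
      also have "(\<Sum>v<N. y v powr p) = (\<Sum>v<N - L. x (N - 1 - v) powr p)"
        using p by (intro sum.mono_neutral_cong_right) (auto simp: y_def)
      also have "\<dots> = (\<Sum>k\<in>{L..<N}. x k powr p)"
        by (rule sum.reindex_bij_witness[where j = "\<lambda>k. N - 1 - k" and i = "\<lambda>k. N - 1 - k"]) auto
      finally show ?thesis using tail[of L N] C by (meson le_refl mult_le_cancel_left_pos order_trans)
    qed
    have SZ: "(\<Sum>u<M. Z u powr p) \<le> \<eta>" for M
    proof -
      have "Z u powr p \<le> real L powr (p - 1) * (\<Sum>k<L. (corner a u (N - 1 - k) * x k) powr p)" for u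
      proof -
        have "Z u = (\<Sum>v\<in>{N - L..<N}. corner a u v * x (N - 1 - v))"
          unfolding Z_def by (intro sum.mono_neutral_cong_right) (auto simp: z_def)
        also have "\<dots> = (\<Sum>k<L. corner a u (N - 1 - k) * x k)"
          by (rule sum.reindex_bij_witness[where j = "\<lambda>k. N - 1 - k" and i = "\<lambda>k. N - 1 - k"]) (use elim in auto)
        finally show ?thesis
          using sum_powr_le[of "{..<L}" p "\<lambda>k. corner a u (N - 1 - k) * x k"] p K0 x0 by simp
      qed
      then have "(\<Sum>u<M. Z u powr p) \<le> (\<Sum>u<M. real L powr (p - 1) * (\<Sum>k<L. (corner a u (N - 1 - k) * x k) powr p))"
        by (rule sum_mono)
      also have "\<dots> = real L powr (p - 1) * (\<Sum>k<L. (\<Sum>u<M. corner a u (N - 1 - k) powr p) * x k powr p)"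
        using K0 x0 by (simp add: sum_distrib_left[symmetric] sum_distrib_right powr_mult sum.swap[of _ "{..<M}"])
      also have "\<dots> \<le> real L powr (p - 1) * (\<Sum>k<L. D * (real (N - 1 - k) + 1) powr - \<delta> * x k powr p)"
        by (intro mult_left_mono sum_mono mult_right_mono D) auto
      also have "\<dots> \<le> \<eta>" using elim by simp
      finally show ?thesis .
    qed
    show ?case
    proof
      fix M
      have "(\<Sum>i<M. R i powr p) \<le> (\<Sum>i<N + M. R i powr p)"
        by (intro sum_mono2) auto
      also have "\<dots> = (\<Sum>i\<in>{N..<N + M}. R i powr p)"
        using p by (intro sum.mono_neutral_right) (auto simp: R0)
      also have "\<dots> = (\<Sum>u<M. R (N + u) powr p)"
        by (rule sum.reindex_bij_witness[where j = "\<lambda>k. k - N" and i = "\<lambda>u. N + u"]) auto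
      also have "\<dots> \<le> (\<Sum>u<M. c * (x (N + u) powr p + c * (Y u powr p + Z u powr p)))"
        by (intro sum_mono R1)
      also have "\<dots> = c * ((\<Sum>u<M. x (N + u) powr p) + c * ((\<Sum>u<M. Y u powr p) + (\<Sum>u<M. Z u powr p)))"
        by (simp only: sum_distrib_left[symmetric] sum.distrib)
      also have "\<dots> \<le> c * (\<eta> + c * (C * \<eta> + \<eta>))"
      proof (intro mult_left_mono add_mono SY SZ)
        have "(\<Sum>u<M. x (N + u) powr p) = (\<Sum>k\<in>{N..<N + M}. x k powr p)"
          by (rule sum.reindex_bij_witness[where j = "\<lambda>u. N + u" and i = "\<lambda>k. k - N"]) auto
        then show "(\<Sum>u<M. x (N + u) powr p) \<le> \<eta>" using tail[of N] elim by simp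
      qed (use c in auto)
      also have "\<dots> = \<eta> * (c * (1 + c * (C + 1)))" by (simp add: algebra_simps)
      also have "\<dots> = \<epsilon>" using pos by (auto simp: \<eta>_def)
      finally show "(\<Sum>i<M. norm (f i - cesaro_op a (\<lambda>n. if n < N then cesaro_op (- a) f n else 0) i) powr p) \<le> \<epsilon>"
        by (simp add: R_def)
    qed
  qed
qed

subsection \<open>Sequence spaces and triangular bases\<close>

lemma lp_normI:
  assumes p: "0 < p" and B: "\<And>M. (\<Sum>i<M. norm (f i) powr p) \<le> B"
  shows "f \<in> lp_space p" "lp_norm p f \<le> B powr (1 / p)"
proof -
  have s: "summable (\<lambda>i. norm (f i) powr p)"
    by (rule summableI_nonneg_bounded[where x = B]) (use B in auto)
  then show "f \<in> lp_space p" by (simp add: lp_space_def)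
  have "(\<Sum>i. norm (f i) powr p) \<le> B" by (rule suminf_le_const[OF s B])
  then show "lp_norm p f \<le> B powr (1 / p)"
    unfolding lp_norm_def by (intro powr_mono2) (use p s in \<open>auto intro!: suminf_nonneg\<close>)
qed

lemma sum_le_lp_norm:
  assumes "0 < p" "f \<in> lp_space p" "finite I"
  shows "(\<Sum>i\<in>I. norm (f i) powr p) \<le> lp_norm p f powr p"
proof -
  have s: "summable (\<lambda>i. norm (f i) powr p)" using assms by (simp add: lp_space_def)
  then have "lp_norm p f powr p = (\<Sum>i. norm (f i) powr p)"
    using assms by (simp add: lp_norm_def powr_powr suminf_nonneg)
  then show ?thesis using sum_le_suminf[OF s assms(3)] by simp
qed

lemma lp_norm_nonneg [simp]: "0 \<le> lp_norm p f"
  by (simp add: lp_norm_def)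

lemma norm_le_lp_norm:
  assumes "0 < p" "f \<in> lp_space p"
  shows "norm (f i) \<le> lp_norm p f"
  using sum_le_lp_norm[OF assms, of "{i}"] assms powr_mono2[of "1 / p" "norm (f i) powr p" "lp_norm p f powr p"]
  by (simp add: powr_powr)

lemma lp_space_add:
  assumes "1 < p" "f \<in> lp_space p" "g \<in> lp_space p"
  shows "(\<lambda>i. f i + g i) \<in> lp_space p"
proof -
  have "summable (\<lambda>i. 2 powr (p - 1) * (norm (f i) powr p + norm (g i) powr p))"
    using assms by (intro summable_mult summable_add) (auto simp: lp_space_def)
  moreover have "norm (norm (f i + g i) powr p) \<le> 2 powr (p - 1) * (norm (f i) powr p + norm (g i) powr p)" for i
  proof -
    have "norm (f i + g i) powr p \<le> (norm (f i) + norm (g i)) powr p"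
      by (intro powr_mono2 norm_triangle_ineq) (use assms in auto)
    also have "\<dots> \<le> 2 powr (p - 1) * (norm (f i) powr p + norm (g i) powr p)"
      by (rule add_powr_le) (use assms in auto)
    finally show ?thesis by simp
  qed
  ultimately show ?thesis
    unfolding lp_space_def mem_Collect_eq
    by (rule summable_comparison_test'[where N = 0])
qed

lemma lp_space_mult:
  assumes "f \<in> lp_space p"
  shows "(\<lambda>i. c * f i) \<in> lp_space p"
  using assms summable_mult[of "\<lambda>i. norm (f i) powr p" "norm c powr p"]
  by (simp add: lp_space_def norm_mult powr_mult)

lemma lp_space_diff:
  assumes "1 < p" "f \<in> lp_space p" "g \<in> lp_space p"
  shows "(\<lambda>i. f i - g i) \<in> lp_space p"
  using lp_space_add[OF assms(1,2) lp_space_mult[OF assms(3), of "- 1"]] by simp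

lemma lp_space_sum:
  assumes "1 < p" "\<And>n. n \<in> A \<Longrightarrow> X n \<in> lp_space p"
  shows "(\<lambda>i. \<Sum>n\<in>A. c n * X n i) \<in> lp_space p"
  using assms(2)
proof (induction A rule: infinite_finite_induct)
  case (insert x F)
  then show ?case
    using lp_space_add[OF assms(1) lp_space_mult[of "X x" p "c x"], of "\<lambda>i. \<Sum>n\<in>F. c n * X n i"] by simp
qed (simp_all add: lp_space_def)

lemma lp_norm_tendsto_0I:
  assumes p: "0 < p"
    and small: "\<And>\<epsilon>. 0 < \<epsilon> \<Longrightarrow> \<forall>\<^sub>F N in F. \<forall>M. (\<Sum>i<M. norm (g N i) powr p) \<le> \<epsilon>"
  shows "((\<lambda>N. lp_norm p (g N)) \<longlongrightarrow> 0) F"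
proof (rule tendstoI)
  fix e :: real assume e: "0 < e"
  have "\<forall>\<^sub>F N in F. \<forall>M. (\<Sum>i<M. norm (g N i) powr p) \<le> (e / 2) powr p"
    by (rule small) (use e in simp)
  then show "\<forall>\<^sub>F N in F. dist (lp_norm p (g N)) 0 < e"
  proof eventually_elim
    case (elim N)
    then have "lp_norm p (g N) \<le> ((e / 2) powr p) powr (1 / p)" using lp_normI[OF p] by blast
    also have "\<dots> = e / 2" using p e by (simp add: powr_powr)
    finally show ?case using e by simp
  qed
qed

text \<open>Norm convergence implies convergence of each coordinate, and coordinate \<open>i\<close>
  of the partial sums is constant once all vectors up to index \<open>i\<close> are included. The
  coefficients therefore solve a triangular system with nonzero diagonal, so any given expansion is
  the only one.\<close>

lemma triangular_schauder_basis:
  fixes X :: "nat \<Rightarrow> nat \<Rightarrow> 'k::real_normed_field"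
  assumes p: "1 < p" and X: "\<And>n. X n \<in> lp_space p"
    and tri: "\<And>n i. i < n \<Longrightarrow> X n i = 0" and diag: "\<And>n. X n n \<noteq> 0"
    and ex: "\<And>f. f \<in> lp_space p \<Longrightarrow> expands (lp_norm p) X f (c f)"
  shows "schauder_basis (lp_space p) (lp_norm p) X"
    and "f \<in> lp_space p \<Longrightarrow> coord_functional (lp_norm p) X n f = c f n"
proof -
  have coord: "f i = (\<Sum>n\<le>i. b n * X n i)" if f: "f \<in> lp_space p" and b: "expands (lp_norm p) X f b" for f b i
  proof -
    have "norm (f i - (\<Sum>n\<le>i. b n * X n i)) \<le> lp_norm p (\<lambda>i. f i - (\<Sum>n<M. b n * X n i))" if "M > i" for M
    proof -
      have "(\<Sum>n<M. b n * X n i) = (\<Sum>n\<le>i. b n * X n i)"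
        using that tri by (intro sum.mono_neutral_right) auto
      moreover have "(\<lambda>i. f i - (\<Sum>n<M. b n * X n i)) \<in> lp_space p"
        by (intro lp_space_diff lp_space_sum p f X)
      ultimately show ?thesis using norm_le_lp_norm[of p "\<lambda>i. f i - (\<Sum>n<M. b n * X n i)" i] p by simp
    qed
    then have "\<forall>\<^sub>F M in sequentially. norm (f i - (\<Sum>n\<le>i. b n * X n i)) \<le> lp_norm p (\<lambda>i. f i - (\<Sum>n<M. b n * X n i))"
      using eventually_gt_at_top[of i] by (rule eventually_mono[rotated])
    with b have "norm (f i - (\<Sum>n\<le>i. b n * X n i)) \<le> 0"
      unfolding expands_def by (intro tendsto_lowerbound) auto
    then show ?thesis by simp
  qed
  have unique: "b = c f" if f: "f \<in> lp_space p" and b: "expands (lp_norm p) X f b" for f b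
  proof
    fix n
    show "b n = c f n"
    proof (induction n rule: less_induct)
      case (less n)
      have "(\<Sum>k\<le>n. b k * X k n) = (\<Sum>k\<le>n. c f k * X k n)"
        using coord[OF f b] coord[OF f ex[OF f]] by metis
      moreover have "(\<Sum>k<n. b k * X k n) = (\<Sum>k<n. c f k * X k n)"
        by (intro sum.cong) (auto simp: less)
      ultimately show ?case using diag[of n] by (simp add: lessThan_Suc_atMost[symmetric])
    qed
  qed
  show "schauder_basis (lp_space p) (lp_norm p) X"
    unfolding schauder_basis_def using X ex unique by blast
  show "coord_functional (lp_norm p) X n f = c f n" if "f \<in> lp_space p"
  proof -
    have "(THE a. expands (lp_norm p) X f a) = c f"
      by (rule the_equality) (use that ex unique in auto)
    then show ?thesis by (simp add: coord_functional_def)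
  qed
qed

subsection \<open>Cesaro convolution restricted to few indices\<close>

definition cesaro_vec :: "real \<Rightarrow> nat \<Rightarrow> nat \<Rightarrow> 'k::real_normed_field" where
  "cesaro_vec a n i = (if n \<le> i then of_real (cesaro a (i - n)) else 0)"

lemma sum_cesaro_vec:
  assumes "finite A"
  shows "(\<Sum>n\<in>A. c n * cesaro_vec a n i) = cesaro_op a (\<lambda>n. if n \<in> A then c n else 0) i"
proof -
  have "(\<Sum>n\<in>A. c n * cesaro_vec a n i) = (\<Sum>n\<in>A \<inter> {..i}. of_real (cesaro a (i - n)) * c n)"
    using assms by (intro sum.mono_neutral_cong_right) (auto simp: cesaro_vec_def)
  also have "\<dots> = cesaro_op a (\<lambda>n. if n \<in> A then c n else 0) i"
    unfolding cesaro_op_def by (intro sum.mono_neutral_cong_left) auto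
  finally show ?thesis .
qed

section \<open>Young's inequality for convolutions on finite sections\<close>

lemma row_sum_le:
  fixes \<kappa> :: "nat \<Rightarrow> real"
  assumes "\<And>d. 0 \<le> \<kappa> d" "i < M"
  shows "(\<Sum>j<M. if j \<le> i then \<kappa> (i - j) else 0) \<le> (\<Sum>d<M. \<kappa> d)"
proof -
  have "(\<Sum>j<M. if j \<le> i then \<kappa> (i - j) else 0) = (\<Sum>j\<le>i. \<kappa> (i - j))"
    using assms by (intro sum.mono_neutral_cong_right) auto
  also have "\<dots> = (\<Sum>d\<le>i. \<kappa> d)"
    by (rule sum.reindex_bij_witness[where j = "\<lambda>j. i - j" and i = "\<lambda>j. i - j"]) auto
  also have "\<dots> \<le> (\<Sum>d<M. \<kappa> d)" using assms by (intro sum_mono2) auto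
  finally show ?thesis .
qed

lemma column_sum_le:
  fixes \<kappa> :: "nat \<Rightarrow> real"
  assumes "\<And>d. 0 \<le> \<kappa> d"
  shows "(\<Sum>i<M. if j \<le> i then \<kappa> (i - j) else 0) \<le> (\<Sum>d<M. \<kappa> d)"
proof -
  have "(\<Sum>i<M. if j \<le> i then \<kappa> (i - j) else 0) = (\<Sum>i\<in>{j..<M}. \<kappa> (i - j))"
    using assms by (intro sum.mono_neutral_cong_right) auto
  also have "\<dots> = (\<Sum>d<M - j. \<kappa> d)"
    by (rule sum.reindex_bij_witness[where j = "\<lambda>i. i - j" and i = "\<lambda>d. j + d"]) auto
  also have "\<dots> \<le> (\<Sum>d<M. \<kappa> d)" using assms by (intro sum_mono2) auto
  finally show ?thesis .
qed

text \<open>Rows and columns of a triangular Toeplitz section have sums at most \<open>S\<close>, so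
  the Schur test applies with constant weights. Summing only over \<open>d < M\<close> admits
  kernels that are not summable.\<close>

lemma convolution_bound:
  fixes \<kappa> x :: "nat \<Rightarrow> real"
  assumes p: "1 < p" and \<kappa>: "\<And>d. 0 \<le> \<kappa> d" and x: "\<And>j. 0 \<le> x j" and S: "(\<Sum>d<M. \<kappa> d) \<le> S" "0 < S"
  shows "(\<Sum>i<M. (\<Sum>j\<le>i. \<kappa> (i - j) * x j) powr p) \<le> S powr p * (\<Sum>j<M. x j powr p)"
proof -
  define K where "K i j = (if j \<le> i then \<kappa> (i - j) else 0)" for i j
  have "(\<Sum>j\<le>i. \<kappa> (i - j) * x j) = (\<Sum>j<M. K i j * x j)" if "i < M" for i
    using that by (intro sum.mono_neutral_cong_left) (auto simp: K_def)
  then have "(\<Sum>i<M. (\<Sum>j\<le>i. \<kappa> (i - j) * x j) powr p) = (\<Sum>i<M. (\<Sum>j<M. K i j * x j) powr p)"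
    by simp
  also have "\<dots> \<le> S powr (p - 1) * S * (\<Sum>j<M. x j powr p)"
  proof (rule schur_test[where w = "\<lambda>_. 1" and h = "\<lambda>_. 1"])
    show "(\<Sum>j<M. K i j * 1) \<le> S * 1" if "i \<in> {..<M}" for i
      using row_sum_le[of \<kappa> i M] \<kappa> S that by (simp add: K_def)
    show "(\<Sum>i<M. K i j * 1 powr (p - 1)) \<le> S * 1 powr (p - 1)" for j
      using column_sum_le[of \<kappa> j M] \<kappa> S by (simp add: K_def)
  qed (use p x \<kappa> S in \<open>auto simp: K_def\<close>)
  also have "S powr (p - 1) * S = S powr p" using S powr_add[of S "p - 1" 1] by simp
  finally show ?thesis .
qed

lemma norm_cesaro_op_le: "norm (cesaro_op a f i) \<le> (\<Sum>j\<le>i. \<bar>cesaro a (i - j)\<bar> * norm (f j))"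
  unfolding cesaro_op_def by (rule order_trans[OF norm_sum]) (simp add: norm_mult)

text \<open>Negative parameters are harmless: the kernel has absolute sum at most 2. The bound holds
  on each initial section because the convolution only looks back.\<close>

lemma cesaro_op_minus_bounded:
  assumes "1 < p" "0 \<le> a" "a \<le> 1"
  shows "(\<Sum>i<M. norm (cesaro_op (- a) f i) powr p) \<le> 2 powr p * (\<Sum>j<M. norm (f j) powr p)"
proof -
  have "(\<Sum>i<M. norm (cesaro_op (- a) f i) powr p)
      \<le> (\<Sum>i<M. (\<Sum>j\<le>i. \<bar>cesaro (- a) (i - j)\<bar> * norm (f j)) powr p)"
    by (intro sum_mono powr_mono2 norm_cesaro_op_le) (use assms in auto)
  also have "\<dots> \<le> 2 powr p * (\<Sum>j<M. norm (f j) powr p)"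
    by (rule convolution_bound[where \<kappa> = "\<lambda>d. \<bar>cesaro (- a) d\<bar>"]) (use assms sum_abs_cesaro_le in auto)
  finally show ?thesis .
qed

text \<open>The kernel cut at distance \<open>m\<close> has sum at most
  \<open>cesaro (1 + a) (m - 1)\<close>, which is of order \<open>m powr a\<close>.\<close>

lemma near_part_bound:
  assumes p: "1 < p" and a: "0 \<le> a"
  obtains C where "0 < C"
    "\<And>m M x. 1 \<le> m \<Longrightarrow> (\<And>j::nat. 0 \<le> x j) \<Longrightarrow>
      (\<Sum>i<M. (\<Sum>j\<le>i. (if i - j < m then cesaro a (i - j) else 0) * x j) powr p)
        \<le> C * real m powr (a * p) * (\<Sum>j<M. x j powr p)"
proof -
  obtain C where C: "0 < C" "\<And>n. cesaro (1 + a) n \<le> C * (real n + 1) powr a"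
    using cesaro_growth[of a] a by (metis less_le_trans neg_less_0_iff_less zero_less_one)
  show ?thesis
  proof (rule that[of "C powr p"])
    fix m M :: nat and x :: "nat \<Rightarrow> real"
    assume m: "1 \<le> m" and x: "\<And>j. 0 \<le> x j"
    have "(\<Sum>d<M. if d < m then cesaro a d else 0) = (\<Sum>d\<in>{..<M} \<inter> {..<m}. cesaro a d)"
      by (intro sum.mono_neutral_cong_right) auto
    also have "\<dots> \<le> (\<Sum>d\<le>m - 1. cesaro a d)"
      using a m by (intro sum_mono2) (auto simp: cesaro_nonneg)
    also have "\<dots> \<le> C * real m powr a" using C(2)[of "m - 1"] m by (simp add: sum_cesaro)
    finally have "(\<Sum>i<M. (\<Sum>j\<le>i. (if i - j < m then cesaro a (i - j) else 0) * x j) powr p)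
        \<le> (C * real m powr a) powr p * (\<Sum>j<M. x j powr p)"
      by (intro convolution_bound[where \<kappa> = "\<lambda>d. if d < m then cesaro a d else 0"])
         (use p a m x C in \<open>auto simp: cesaro_nonneg\<close>)
    then show "(\<Sum>i<M. (\<Sum>j\<le>i. (if i - j < m then cesaro a (i - j) else 0) * x j) powr p)
        \<le> C powr p * real m powr (a * p) * (\<Sum>j<M. x j powr p)"
      using C by (simp add: powr_mult powr_powr)
  qed (use C in auto)
qed

lemma norm_cesaro_op_powr_le:
  assumes p: "1 < p" and a: "0 \<le> a"
  shows "norm (cesaro_op a f i) powr p \<le> 2 powr (p - 1) *
    ((\<Sum>j\<le>i. (if i - j < m then cesaro a (i - j) else 0) * norm (f j)) powr p
     + (\<Sum>j\<le>i. (if i - j < m then 0 else cesaro a (i - j)) * norm (f j)) powr p)"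
proof -
  have "norm (cesaro_op a f i) \<le> (\<Sum>j\<le>i. cesaro a (i - j) * norm (f j))"
    using norm_cesaro_op_le[of a f i] a by (simp add: cesaro_nonneg)
  also have "\<dots> = (\<Sum>j\<le>i. (if i - j < m then cesaro a (i - j) else 0) * norm (f j))
     + (\<Sum>j\<le>i. (if i - j < m then 0 else cesaro a (i - j)) * norm (f j))"
    unfolding sum.distrib[symmetric] by (intro sum.cong) auto
  finally have "norm (cesaro_op a f i) powr p \<le> (\<dots>) powr p"
    by (intro powr_mono2) (use p in auto)
  also have "\<dots> \<le> 2 powr (p - 1) *
    ((\<Sum>j\<le>i. (if i - j < m then cesaro a (i - j) else 0) * norm (f j)) powr p
     + (\<Sum>j\<le>i. (if i - j < m then 0 else cesaro a (i - j)) * norm (f j)) powr p)"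
    by (intro add_powr_le p sum_nonneg mult_nonneg_nonneg) (use a in \<open>auto simp: cesaro_nonneg\<close>)
  finally show ?thesis .
qed

text \<open>The kernel is split at distance \<open>m\<close>: Young's inequality bounds the near part, and for the far part
  Hoelder's inequality is applied to the at most \<open>m\<close> nonzero inputs.\<close>

lemma cesaro_op_restricted_input_bound:
  assumes p: "1 < p" and a: "0 \<le> a" "a < 1 - 1 / p"
  obtains C where "0 < C"
    "\<And>m M B (f :: nat \<Rightarrow> 'k::real_normed_field). 1 \<le> m \<Longrightarrow> finite B \<Longrightarrow> card B \<le> m \<Longrightarrow> (\<And>j. j \<notin> B \<Longrightarrow> f j = 0) \<Longrightarrow>
      (\<Sum>i<M. norm (cesaro_op a f i) powr p) \<le> C * real m powr (a * p) * (\<Sum>j<M. norm (f j) powr p)"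
proof -
  have p1: "1 / p < 1" "0 < 1 / p" using p by simp_all
  obtain C1 where C1: "0 < C1" "\<And>m M x. 1 \<le> m \<Longrightarrow> (\<And>j::nat. 0 \<le> x j) \<Longrightarrow>
      (\<Sum>i<M. (\<Sum>j\<le>i. (if i - j < m then cesaro a (i - j) else 0) * x j) powr p)
        \<le> C1 * real m powr (a * p) * (\<Sum>j<M. x j powr p)"
    using near_part_bound[OF p a(1)] by blast
  obtain D where D: "0 < D" "\<And>n. \<bar>cesaro a n\<bar> \<le> D * (real n + 1) powr (a - 1)"
    using abs_cesaro_le[of a] a p1 by (smt (verit))
  \<comment> \<open>The p-th power of the kernel is of order \<open>d powr (- 1 - r)\<close>, with
    tail \<open>m powr - r\<close> beyond \<open>m\<close>. Multiplied by Hoelder's factor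
    \<open>m powr (p - 1)\<close> this gives \<open>m powr (a * p)\<close>, the same order as the
    near part.\<close>
  define r where "r = (1 - a) * p - 1"
  have r: "r > 0" using a p by (simp add: r_def field_simps)
  define C2 where "C2 = D powr p * (1 + 1 / r)"
  have C2: "C2 > 0" unfolding C2_def using D r by (intro mult_pos_pos add_pos_pos) auto
  show ?thesis
  proof (rule that[of "2 powr (p - 1) * (C1 + C2)"])
    fix m M :: nat and B and f :: "nat \<Rightarrow> 'k"
    assume m: "1 \<le> m" and B: "finite B" "card B \<le> m" "\<And>j. j \<notin> B \<Longrightarrow> f j = 0"
    define \<kappa> where "\<kappa> d = (if d < m then 0 else cesaro a d)" for d
    have \<kappa>0: "\<kappa> d \<ge> 0" for d using a by (simp add: \<kappa>_def cesaro_nonneg)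
    define Q where "Q = (\<Sum>j<M. norm (f j) powr p)"
    have near: "(\<Sum>i<M. (\<Sum>j\<le>i. (if i - j < m then cesaro a (i - j) else 0) * norm (f j)) powr p)
        \<le> C1 * real m powr (a * p) * Q"
      unfolding Q_def by (rule C1) (use m in auto)
    have \<kappa>: "(\<Sum>d<M. \<kappa> d powr p) \<le> C2 * real m powr - r"
    proof -
      have "(\<Sum>d<M. \<kappa> d powr p) = (\<Sum>d\<in>{m..<M}. cesaro a d powr p)"
        using p by (intro sum.mono_neutral_cong_right) (auto simp: \<kappa>_def)
      also have "\<dots> \<le> (\<Sum>d\<in>{m..<M}. D powr p * (real d + 1) powr (- 1 - r))"
      proof (intro sum_mono)
        fix d
        have "cesaro a d powr p \<le> (D * (real d + 1) powr (a - 1)) powr p"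
          using D(2)[of d] a p by (intro powr_mono2) (auto simp: cesaro_nonneg)
        also have "\<dots> = D powr p * (real d + 1) powr ((a - 1) * p)"
          using D by (simp add: powr_mult powr_powr)
        also have "(a - 1) * p = - 1 - r" by (simp add: r_def algebra_simps)
        finally show "cesaro a d powr p \<le> D powr p * (real d + 1) powr (- 1 - r)" .
      qed
      also have "\<dots> = D powr p * (\<Sum>d\<in>{m..<M}. (real d + 1) powr (- 1 - r))"
        by (simp add: sum_distrib_left)
      also have "\<dots> \<le> D powr p * ((1 + 1 / r) * (real m + 1) powr - r)"
        by (intro mult_left_mono sum_powr_tail_le r) auto
      also have "\<dots> = C2 * (real m + 1) powr - r" by (simp add: C2_def)
      also have "\<dots> \<le> C2 * real m powr - r"
        using C2 m r by (intro mult_left_mono powr_mono2') auto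
      finally show ?thesis .
    qed
    have "(\<Sum>j\<le>i. \<kappa> (i - j) * norm (f j)) powr p
        \<le> real m powr (p - 1) * (\<Sum>j<M. (if j \<le> i then \<kappa> (i - j) powr p else 0) * norm (f j) powr p)" if "i < M" for i
    proof -
      have "(\<Sum>j\<le>i. \<kappa> (i - j) * norm (f j)) = (\<Sum>j\<in>B \<inter> {..i}. \<kappa> (i - j) * norm (f j))"
        using B by (intro sum.mono_neutral_right) auto
      also have "\<dots> powr p \<le> real (card (B \<inter> {..i})) powr (p - 1) * (\<Sum>j\<in>B \<inter> {..i}. (\<kappa> (i - j) * norm (f j)) powr p)"
        by (rule sum_powr_le) (use p \<kappa>0 in auto)
      also have "\<dots> \<le> real m powr (p - 1) * (\<Sum>j\<in>B \<inter> {..i}. (\<kappa> (i - j) * norm (f j)) powr p)"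
        using card_mono[of B "B \<inter> {..i}"] B p by (intro mult_right_mono powr_mono2 sum_nonneg) auto
      also have "(\<Sum>j\<in>B \<inter> {..i}. (\<kappa> (i - j) * norm (f j)) powr p)
          = (\<Sum>j<M. (if j \<le> i then \<kappa> (i - j) powr p else 0) * norm (f j) powr p)"
        using B that p \<kappa>0 by (intro sum.mono_neutral_cong_left) (auto simp: powr_mult)
      finally show ?thesis .
    qed
    then have "(\<Sum>i<M. (\<Sum>j\<le>i. \<kappa> (i - j) * norm (f j)) powr p)
        \<le> (\<Sum>i<M. real m powr (p - 1) * (\<Sum>j<M. (if j \<le> i then \<kappa> (i - j) powr p else 0) * norm (f j) powr p))"
      by (intro sum_mono) auto
    also have "\<dots> = real m powr (p - 1) * (\<Sum>j<M. (\<Sum>i<M. if j \<le> i then \<kappa> (i - j) powr p else 0) * norm (f j) powr p)"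
      unfolding sum_distrib_left[symmetric] sum_distrib_right by (subst sum.swap) (rule refl)
    also have "\<dots> \<le> real m powr (p - 1) * (\<Sum>j<M. (C2 * real m powr - r) * norm (f j) powr p)"
      by (intro mult_left_mono sum_mono mult_right_mono order_trans[OF column_sum_le \<kappa>]) auto
    also have "\<dots> = C2 * (real m powr (p - 1) * real m powr - r) * Q"
      by (simp add: Q_def sum_distrib_left mult_ac)
    also have "real m powr (p - 1) * real m powr - r = real m powr (a * p)"
      by (simp add: powr_add[symmetric] r_def algebra_simps)
    finally have far: "(\<Sum>i<M. (\<Sum>j\<le>i. \<kappa> (i - j) * norm (f j)) powr p) \<le> C2 * real m powr (a * p) * Q" .
    have "(\<Sum>i<M. norm (cesaro_op a f i) powr p)
       \<le> (\<Sum>i<M. 2 powr (p - 1) * ((\<Sum>j\<le>i. (if i - j < m then cesaro a (i - j) else 0) * norm (f j)) powr p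
          + (\<Sum>j\<le>i. \<kappa> (i - j) * norm (f j)) powr p))"
      unfolding \<kappa>_def by (intro sum_mono norm_cesaro_op_powr_le p a)
    also have "\<dots> = 2 powr (p - 1) * ((\<Sum>i<M. (\<Sum>j\<le>i. (if i - j < m then cesaro a (i - j) else 0) * norm (f j)) powr p)
          + (\<Sum>i<M. (\<Sum>j\<le>i. \<kappa> (i - j) * norm (f j)) powr p))"
      by (simp add: sum_distrib_left sum.distrib distrib_left)
    also have "\<dots> \<le> 2 powr (p - 1) * (C1 * real m powr (a * p) * Q + C2 * real m powr (a * p) * Q)"
      by (intro mult_left_mono add_mono near far) auto
    finally show "(\<Sum>i<M. norm (cesaro_op a f i) powr p)
        \<le> 2 powr (p - 1) * (C1 + C2) * real m powr (a * p) * (\<Sum>j<M. norm (f j) powr p)"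
      by (simp add: Q_def algebra_simps)
  qed (use C1 C2 in auto)
qed

text \<open>Dually, each far output is bounded through the \<open>\<ell>\<^sub>q\<close> norm of the kernel beyond distance \<open>m\<close>,
  where \<open>1 / p + 1 / q = 1\<close>.\<close>

lemma cesaro_op_restricted_output_bound:
  assumes p: "1 < p" and b: "0 \<le> b" "b < 1 / p"
  obtains C where "0 < C"
    "\<And>m E (f :: nat \<Rightarrow> 'k::real_normed_field) Q. 1 \<le> m \<Longrightarrow> finite E \<Longrightarrow> card E \<le> m \<Longrightarrow> (\<And>M. (\<Sum>j<M. norm (f j) powr p) \<le> Q) \<Longrightarrow>
      (\<Sum>i\<in>E. norm (cesaro_op b f i) powr p) \<le> C * real m powr (b * p) * Q"
proof -
  have p1: "1 / p < 1" "0 < 1 / p" using p by simp_all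
  obtain C1 where C1: "0 < C1" "\<And>m M x. 1 \<le> m \<Longrightarrow> (\<And>j::nat. 0 \<le> x j) \<Longrightarrow>
      (\<Sum>i<M. (\<Sum>j\<le>i. (if i - j < m then cesaro b (i - j) else 0) * x j) powr p)
        \<le> C1 * real m powr (b * p) * (\<Sum>j<M. x j powr p)"
    using near_part_bound[OF p b(1)] by blast
  obtain D where D: "0 < D" "\<And>n. \<bar>cesaro b n\<bar> \<le> D * (real n + 1) powr (b - 1)"
    using abs_cesaro_le[of b] b p1 by (smt (verit))
  \<comment> \<open>With the conjugate exponent, the q-th power of the kernel beyond
    \<open>m\<close> sums to order \<open>m powr - r\<close>. Since
    \<open>r * (p - 1) = 1 - b * p\<close>, each far output has p-th power of order
    \<open>m powr (b * p - 1)\<close>, and at most \<open>m\<close> outputs are counted.\<close>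
  define q where "q = p / (p - 1)"
  have q: "q + p = q * p" "q > 1" using p by (auto simp: q_def field_simps)
  define r where "r = (1 - b) * q - 1"
  have bp: "b * p < 1" using b p by (simp add: field_simps)
  have r: "r > 0" "r * (p - 1) = 1 - b * p" using bp p by (simp_all add: r_def q_def field_simps)
  define C2 where "C2 = D powr p * (1 + 1 / r) powr (p - 1)"
  have "1 + 1 / r > 0" using r by (simp add: add_pos_pos)
  then have C2: "C2 > 0" unfolding C2_def using D by (intro mult_pos_pos) auto
  show ?thesis
  proof (rule that[of "2 powr (p - 1) * (C1 + C2)"])
    fix m :: nat and E :: "nat set" and f :: "nat \<Rightarrow> 'k" and Q :: real
    assume m: "1 \<le> m" and E: "finite E" "card E \<le> m" and Q: "\<And>M. (\<Sum>j<M. norm (f j) powr p) \<le> Q"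
    have Q0: "Q \<ge> 0" using Q[of 0] by simp
    have near: "(\<Sum>i\<in>E. (\<Sum>j\<le>i. (if i - j < m then cesaro b (i - j) else 0) * norm (f j)) powr p)
        \<le> C1 * real m powr (b * p) * Q"
    proof -
      obtain M where "E \<subseteq> {..<M}" using E(1) finite_nat_iff_bounded by auto
      then have "(\<Sum>i\<in>E. (\<Sum>j\<le>i. (if i - j < m then cesaro b (i - j) else 0) * norm (f j)) powr p)
          \<le> (\<Sum>i<M. (\<Sum>j\<le>i. (if i - j < m then cesaro b (i - j) else 0) * norm (f j)) powr p)"
        by (intro sum_mono2) auto
      also have "\<dots> \<le> C1 * real m powr (b * p) * (\<Sum>j<M. norm (f j) powr p)"
        by (rule C1) (use m in auto)
      also have "\<dots> \<le> C1 * real m powr (b * p) * Q"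
        using C1 by (intro mult_left_mono Q) auto
      finally show ?thesis .
    qed
    have far1: "(\<Sum>j\<le>i. (if i - j < m then 0 else cesaro b (i - j)) * norm (f j)) powr p
        \<le> C2 * real m powr (b * p - 1) * Q" for i
    proof -
      define J where "J = {j. j + m \<le> i}"
      have fin: "finite J" by (rule finite_subset[of _ "{..i}"]) (auto simp: J_def)
      define t where "t j = real (i - j) + 1" for j
      have t: "t j > 0" for j by (simp add: t_def add_nonneg_pos)
      have "(\<Sum>j\<le>i. (if i - j < m then 0 else cesaro b (i - j)) * norm (f j)) = (\<Sum>j\<in>J. cesaro b (i - j) * norm (f j))"
        by (intro sum.mono_neutral_cong_right) (auto simp: J_def)
      also have "\<dots> \<le> (\<Sum>j\<in>J. (D * t j powr (b - 1)) * norm (f j))"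
        using D(2) b by (intro sum_mono mult_right_mono) (auto simp: t_def abs_le_iff)
      \<comment> \<open>The kernel is factored so that the weighted power mean becomes Hoelder's
        inequality: the weights are the q-th powers of the kernel, and the p-th power of the other
        factor cancels them because \<open>q + p = q * p\<close>.\<close>
      also have "\<dots> = D * (\<Sum>j\<in>J. t j powr ((b - 1) * q) * (t j powr ((b - 1) * (1 - q)) * norm (f j)))"
      proof -
        have "t j powr ((b - 1) * q) * t j powr ((b - 1) * (1 - q)) = t j powr (b - 1)" for j
          by (simp add: powr_add[symmetric] algebra_simps)
        then show ?thesis by (simp add: sum_distrib_left flip: mult.assoc)
      qed
      finally have "(\<Sum>j\<le>i. (if i - j < m then 0 else cesaro b (i - j)) * norm (f j)) powr p
          \<le> (D * (\<Sum>j\<in>J. t j powr ((b - 1) * q) * (t j powr ((b - 1) * (1 - q)) * norm (f j)))) powr p"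
        using p b by (intro powr_mono2 sum_nonneg mult_nonneg_nonneg) (auto simp: cesaro_nonneg)
      also have "\<dots> = D powr p * (\<Sum>j\<in>J. t j powr ((b - 1) * q) * (t j powr ((b - 1) * (1 - q)) * norm (f j))) powr p"
        using D by (intro powr_mult)
      also have "\<dots> \<le> D powr p * ((\<Sum>j\<in>J. t j powr ((b - 1) * q)) powr (p - 1)
           * (\<Sum>j\<in>J. t j powr ((b - 1) * q) * (t j powr ((b - 1) * (1 - q)) * norm (f j)) powr p))"
        by (intro mult_left_mono weighted_power_mean fin p) auto
      also have "(\<Sum>j\<in>J. t j powr ((b - 1) * q) * (t j powr ((b - 1) * (1 - q)) * norm (f j)) powr p)
          = (\<Sum>j\<in>J. norm (f j) powr p)"
      proof (intro sum.cong refl)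
        fix j
        have "(b - 1) * q + (b - 1) * (1 - q) * p = (b - 1) * (q + p - q * p)" by (simp add: algebra_simps)
        also have "\<dots> = 0" using q by simp
        finally have "t j powr ((b - 1) * q) * t j powr ((b - 1) * (1 - q) * p) = 1"
          using t[of j] by (simp add: powr_add[symmetric])
        then show "t j powr ((b - 1) * q) * (t j powr ((b - 1) * (1 - q)) * norm (f j)) powr p = norm (f j) powr p"
          by (simp add: powr_mult powr_powr flip: mult.assoc)
      qed
      also have "D powr p * ((\<Sum>j\<in>J. t j powr ((b - 1) * q)) powr (p - 1) * (\<Sum>j\<in>J. norm (f j) powr p))
          \<le> D powr p * (((1 + 1 / r) * real m powr - r) powr (p - 1) * Q)"
      proof (intro mult_left_mono mult_mono powr_mono2)
        have "(\<Sum>j\<in>J. norm (f j) powr p) \<le> (\<Sum>j<Suc i. norm (f j) powr p)"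
          by (intro sum_mono2) (auto simp: J_def)
        then show "(\<Sum>j\<in>J. norm (f j) powr p) \<le> Q" using Q order_trans by blast
        have "(b - 1) * q = - 1 - r" by (simp add: r_def algebra_simps)
        then have "(\<Sum>j\<in>J. t j powr ((b - 1) * q)) = (\<Sum>d\<in>{m..<Suc i}. (real d + 1) powr (- 1 - r))"
          by (intro sum.reindex_bij_witness[where j = "\<lambda>j. i - j" and i = "\<lambda>d. i - d"]) (auto simp: J_def t_def)
        also have "\<dots> \<le> (1 + 1 / r) * (real m + 1) powr - r" by (rule sum_powr_tail_le[OF r(1)])
        also have "\<dots> \<le> (1 + 1 / r) * real m powr - r"
          using m r by (intro mult_left_mono powr_mono2') auto
        finally show "(\<Sum>j\<in>J. t j powr ((b - 1) * q)) \<le> (1 + 1 / r) * real m powr - r" .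
      qed (use p Q0 in \<open>auto intro!: sum_nonneg\<close>)
      also have "\<dots> = C2 * real m powr (- r * (p - 1)) * Q"
        using r by (simp add: C2_def powr_mult powr_powr mult_ac)
      also have "- r * (p - 1) = b * p - 1" using r(2) by simp
      finally show ?thesis .
    qed
    have "(\<Sum>i\<in>E. (\<Sum>j\<le>i. (if i - j < m then 0 else cesaro b (i - j)) * norm (f j)) powr p)
        \<le> real (card E) * (C2 * real m powr (b * p - 1) * Q)"
      using sum_mono[of E, OF far1] by simp
    also have "\<dots> \<le> real m * (C2 * real m powr (b * p - 1) * Q)"
      using E C2 Q0 by (intro mult_right_mono) auto
    also have "\<dots> = C2 * real m powr (b * p) * Q"
      using m by (simp add: powr_diff)
    finally have far: "(\<Sum>i\<in>E. (\<Sum>j\<le>i. (if i - j < m then 0 else cesaro b (i - j)) * norm (f j)) powr p)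
        \<le> C2 * real m powr (b * p) * Q" .
    have "(\<Sum>i\<in>E. norm (cesaro_op b f i) powr p)
       \<le> (\<Sum>i\<in>E. 2 powr (p - 1) * ((\<Sum>j\<le>i. (if i - j < m then cesaro b (i - j) else 0) * norm (f j)) powr p
          + (\<Sum>j\<le>i. (if i - j < m then 0 else cesaro b (i - j)) * norm (f j)) powr p))"
      by (intro sum_mono norm_cesaro_op_powr_le p b)
    also have "\<dots> = 2 powr (p - 1) * ((\<Sum>i\<in>E. (\<Sum>j\<le>i. (if i - j < m then cesaro b (i - j) else 0) * norm (f j)) powr p)
          + (\<Sum>i\<in>E. (\<Sum>j\<le>i. (if i - j < m then 0 else cesaro b (i - j)) * norm (f j)) powr p))"
      by (simp add: sum_distrib_left sum.distrib distrib_left)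
    also have "\<dots> \<le> 2 powr (p - 1) * (C1 * real m powr (b * p) * Q + C2 * real m powr (b * p) * Q)"
      by (intro mult_left_mono add_mono near far) auto
    finally show "(\<Sum>i\<in>E. norm (cesaro_op b f i) powr p) \<le> 2 powr (p - 1) * (C1 + C2) * real m powr (b * p) * Q"
      by (simp add: algebra_simps)
  qed (use C1 C2 in auto)
qed

subsection \<open>The mixed basis\<close>

lemma sum_even_odd:
  fixes F :: "nat \<Rightarrow> 'a::comm_monoid_add"
  assumes "finite A"
  shows "(\<Sum>n\<in>A. F n) = (\<Sum>k | 2 * k \<in> A. F (2 * k)) + (\<Sum>k | 2 * k + 1 \<in> A. F (2 * k + 1))"
proof -
  have "(\<Sum>n\<in>A. F n) = (\<Sum>n\<in>{n\<in>A. even n} \<union> {n\<in>A. odd n}. F n)"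
    by (intro sum.cong) auto
  also have "\<dots> = (\<Sum>n | n \<in> A \<and> even n. F n) + (\<Sum>n | n \<in> A \<and> odd n. F n)"
    using assms by (intro sum.union_disjoint) auto
  also have "(\<Sum>n | n \<in> A \<and> even n. F n) = (\<Sum>k | 2 * k \<in> A. F (2 * k))"
    by (rule sum.reindex_bij_witness[where j = "\<lambda>n. n div 2" and i = "\<lambda>k. 2 * k"]) auto
  also have "(\<Sum>n | n \<in> A \<and> odd n. F n) = (\<Sum>k | 2 * k + 1 \<in> A. F (2 * k + 1))"
    by (rule sum.reindex_bij_witness[where j = "\<lambda>n. n div 2" and i = "\<lambda>k. 2 * k + 1"]) auto
  finally show ?thesis .
qed

lemma sum_even_odd_lessThan:
  fixes F :: "nat \<Rightarrow> 'a::comm_monoid_add"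
  shows "(\<Sum>n<2 * M. F n) = (\<Sum>k<M. F (2 * k)) + (\<Sum>k<M. F (2 * k + 1))"
proof -
  have "{k. 2 * k < 2 * M} = {..<M}" "{k. 2 * k + 1 < 2 * M} = {..<M}" by auto
  then show ?thesis using sum_even_odd[of "{..<2 * M}" F] by simp
qed

lemma sum_even_odd_ge:
  fixes F :: "nat \<Rightarrow> real"
  assumes "\<And>n. 0 \<le> F n"
  shows "(\<Sum>n<M. F n) \<le> (\<Sum>k<M. F (2 * k)) + (\<Sum>k<M. F (2 * k + 1))"
  unfolding sum_even_odd_lessThan[symmetric] using assms by (intro sum_mono2) auto

lemma lp_space_even_odd:
  assumes "0 < p" "f \<in> lp_space p"
  shows "(\<lambda>j. f (2 * j)) \<in> lp_space p" "(\<lambda>j. f (2 * j + 1)) \<in> lp_space p"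
    "(\<Sum>j<M. norm (f (2 * j)) powr p) \<le> lp_norm p f powr p"
    "(\<Sum>j<M. norm (f (2 * j + 1)) powr p) \<le> lp_norm p f powr p"
proof -
  have le: "(\<Sum>j<M. norm (f (2 * j)) powr p) + (\<Sum>j<M. norm (f (2 * j + 1)) powr p) \<le> lp_norm p f powr p" for M
    unfolding sum_even_odd_lessThan[symmetric, of "\<lambda>i. norm (f i) powr p"] by (rule sum_le_lp_norm) (use assms in auto)
  have even: "(\<Sum>j<M. norm (f (2 * j)) powr p) \<le> lp_norm p f powr p" for M
    by (rule order_trans[OF _ le[of M]]) (auto intro: sum_nonneg)
  have odd: "(\<Sum>j<M. norm (f (2 * j + 1)) powr p) \<le> lp_norm p f powr p" for M
    by (rule order_trans[OF _ le[of M]]) (auto intro: sum_nonneg)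
  show "(\<lambda>j. f (2 * j)) \<in> lp_space p" "(\<lambda>j. f (2 * j + 1)) \<in> lp_space p"
    using lp_normI(1)[OF assms(1), OF even] lp_normI(1)[OF assms(1), OF odd] .
  show "(\<Sum>j<M. norm (f (2 * j)) powr p) \<le> lp_norm p f powr p"
    "(\<Sum>j<M. norm (f (2 * j + 1)) powr p) \<le> lp_norm p f powr p"
    by (rule even, rule odd)
qed

text \<open>The even and the odd coordinates carry the two copies of \<open>\<ell>\<^sub>p\<close>; the vectors with index \<open>2 * n\<close> and
  \<open>2 * n + 1\<close> are \<open>(x\<^sub>n, y\<^sub>n)\<close> and \<open>(0, y\<^sub>n)\<close>.\<close>

definition mixed_basis :: "real \<Rightarrow> real \<Rightarrow> nat \<Rightarrow> nat \<Rightarrow> 'k::real_normed_field" where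
  "mixed_basis a b n i =
    (if odd i then cesaro_vec a (n div 2) (i div 2)
     else if even n then cesaro_vec (- b) (n div 2) (i div 2) else 0)"

text \<open>The first component involves only the vectors \<open>(x\<^sub>n, y\<^sub>n)\<close>, so
  their coefficients are the x-coefficients of the even part of \<open>f\<close>. The y-coefficients
  of the odd part are the sums of both kinds, whence the difference for odd
  \<open>n\<close>.\<close>

definition mixed_coeff :: "real \<Rightarrow> real \<Rightarrow> (nat \<Rightarrow> 'k::real_normed_field) \<Rightarrow> nat \<Rightarrow> 'k" where
  "mixed_coeff a b f n =
    (if even n then cesaro_op b (\<lambda>j. f (2 * j)) (n div 2)
     else cesaro_op (- a) (\<lambda>j. f (2 * j + 1)) (n div 2) - cesaro_op b (\<lambda>j. f (2 * j)) (n div 2))"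

lemma finite_even_odd_indices:
  assumes "finite (A :: nat set)"
  shows "finite {k. 2 * k \<in> A}" "finite {k. 2 * k + 1 \<in> A}"
proof -
  show "finite {k. 2 * k \<in> A}"
    by (rule finite_subset[OF _ finite_imageI[OF assms, of "\<lambda>n. n div 2"]]) force
  show "finite {k. 2 * k + 1 \<in> A}"
    by (rule finite_subset[OF _ finite_imageI[OF assms, of "\<lambda>n. n div 2"]]) force
qed

lemma sum_mixed_basis_even:
  assumes "finite A"
  shows "(\<Sum>n\<in>A. c n * mixed_basis a b n (2 * j)) = cesaro_op (- b) (\<lambda>k. if 2 * k \<in> A then c (2 * k) else 0) j"
  using sum_cesaro_vec[OF finite_even_odd_indices(1)[OF assms], of "\<lambda>k. c (2 * k)" "- b" j]
  by (simp add: sum_even_odd[OF assms] mixed_basis_def)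

lemma sum_mixed_basis_odd:
  assumes "finite A"
  shows "(\<Sum>n\<in>A. c n * mixed_basis a b n (2 * j + 1)) = cesaro_op a
    (\<lambda>k. (if 2 * k \<in> A then c (2 * k) else 0) + (if 2 * k + 1 \<in> A then c (2 * k + 1) else 0)) j"
  using sum_cesaro_vec[OF finite_even_odd_indices(1)[OF assms], of "\<lambda>k. c (2 * k)" a j]
    sum_cesaro_vec[OF finite_even_odd_indices(2)[OF assms], of "\<lambda>k. c (2 * k + 1)" a j]
  by (simp add: sum_even_odd[OF assms] mixed_basis_def cesaro_op_plus)

section \<open>Expansions in the mixed basis\<close>

lemma sum_abs_cesaro_powr_bounded:
  assumes "1 < p" "- 1 < a" "a < 1 - 1 / p"
  obtains V where "0 < V" "\<And>M. (\<Sum>d<M. \<bar>cesaro a d\<bar> powr p) \<le> V"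
proof -
  have p1: "0 < 1 / p" using assms by simp
  obtain D where D: "0 < D" "\<And>n. \<bar>cesaro a n\<bar> \<le> D * (real n + 1) powr (a - 1)"
    using abs_cesaro_le[of a] assms p1 by (smt (verit))
  define r where "r = (1 - a) * p - 1"
  have r: "r > 0" using assms by (simp add: r_def field_simps)
  show ?thesis
  proof (rule that[of "D powr p * (1 + 1 / r)"])
    fix M
    have "(\<Sum>d<M. \<bar>cesaro a d\<bar> powr p) \<le> (\<Sum>d<M. D powr p * (real d + 1) powr (- 1 - r))"
    proof (intro sum_mono)
      fix d
      have "\<bar>cesaro a d\<bar> powr p \<le> (D * (real d + 1) powr (a - 1)) powr p"
        using assms by (intro powr_mono2 D) auto
      also have "\<dots> = D powr p * (real d + 1) powr ((a - 1) * p)"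
        using D by (simp add: powr_mult powr_powr)
      also have "(a - 1) * p = - 1 - r" by (simp add: r_def algebra_simps)
      finally show "\<bar>cesaro a d\<bar> powr p \<le> D powr p * (real d + 1) powr (- 1 - r)" .
    qed
    also have "\<dots> = D powr p * (\<Sum>d\<in>{0..<M}. (real d + 1) powr (- 1 - r))"
      by (simp add: sum_distrib_left atLeast0LessThan)
    also have "\<dots> \<le> D powr p * ((1 + 1 / r) * (real 0 + 1) powr - r)"
      by (intro mult_left_mono sum_powr_tail_le r) auto
    finally show "(\<Sum>d<M. \<bar>cesaro a d\<bar> powr p) \<le> D powr p * (1 + 1 / r)" by simp
  qed (use D r in \<open>auto intro!: mult_pos_pos add_pos_pos\<close>)
qed

lemma sum_cesaro_vec_powr_le:
  fixes a :: real
  assumes "\<And>M. (\<Sum>d<M. \<bar>cesaro a d\<bar> powr p) \<le> V"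
  shows "(\<Sum>i<M. norm (cesaro_vec a n i :: 'k::real_normed_field) powr p) \<le> V"
proof -
  have "(\<Sum>i<M. norm (cesaro_vec a n i :: 'k) powr p) = (\<Sum>i\<in>{n..<M}. \<bar>cesaro a (i - n)\<bar> powr p)"
    by (intro sum.mono_neutral_cong_right) (auto simp: cesaro_vec_def)
  also have "\<dots> = (\<Sum>d<M - n. \<bar>cesaro a d\<bar> powr p)"
    by (rule sum.reindex_bij_witness[where j = "\<lambda>i. i - n" and i = "\<lambda>d. n + d"]) auto
  finally show ?thesis using assms by simp
qed

lemma mixed_basis_in_lp_space:
  assumes "1 < p" "- 1 < a" "a < 1 - 1 / p" "0 \<le> b" "b < 1 / p"
  shows "(mixed_basis a b n :: nat \<Rightarrow> 'k::real_normed_field) \<in> lp_space p"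
proof -
  have p1: "1 / p < 1" "0 < 1 / p" using assms by simp_all
  obtain V where V: "\<And>M. (\<Sum>d<M. \<bar>cesaro a d\<bar> powr p) \<le> V"
    using sum_abs_cesaro_powr_bounded[of p a] assms by blast
  obtain U where U: "0 < U" "\<And>M. (\<Sum>d<M. \<bar>cesaro (- b) d\<bar> powr p) \<le> U"
    using sum_abs_cesaro_powr_bounded[of p "- b"] assms p1 by (smt (verit))
  show ?thesis
  proof (rule lp_normI(1)[where B = "U + V"])
    fix M
    have "(\<Sum>i<M. norm (mixed_basis a b n i :: 'k) powr p)
      \<le> (\<Sum>j<M. norm (mixed_basis a b n (2 * j) :: 'k) powr p) + (\<Sum>j<M. norm (mixed_basis a b n (2 * j + 1) :: 'k) powr p)"
      by (rule sum_even_odd_ge) simp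
    also have "\<dots> \<le> U + V"
    proof (rule add_mono)
      show "(\<Sum>j<M. norm (mixed_basis a b n (2 * j) :: 'k) powr p) \<le> U"
        using sum_cesaro_vec_powr_le[OF U(2), of "n div 2" M, where 'k = 'k] U
        by (cases "even n") (simp_all add: mixed_basis_def)
      show "(\<Sum>j<M. norm (mixed_basis a b n (2 * j + 1) :: 'k) powr p) \<le> V"
        using sum_cesaro_vec_powr_le[OF V, of "n div 2" M, where 'k = 'k] by (simp add: mixed_basis_def)
    qed
    finally show "(\<Sum>i<M. norm (mixed_basis a b n i :: 'k) powr p) \<le> U + V" .
  qed (use assms in simp)
qed

lemma mixed_basis_expands:
  fixes f :: "nat \<Rightarrow> 'k::real_normed_field"
  assumes p: "1 < p" and a: "0 \<le> a" "a < 1 - 1 / p" and b: "0 \<le> b" "b < 1 / p" and f: "f \<in> lp_space p"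
  shows "expands (lp_norm p) (mixed_basis a b) f (mixed_coeff a b f)"
  unfolding expands_def
proof (rule lp_norm_tendsto_0I)
  fix \<epsilon> :: real assume \<epsilon>: "0 < \<epsilon>"
  have p1: "1 / p < 1" "0 < 1 / p" using p by simp_all
  define g where "g j = f (2 * j)" for j
  define h where "h j = f (2 * j + 1)" for j
  have g: "g \<in> lp_space p" and h: "h \<in> lp_space p"
    unfolding g_def h_def by (intro lp_space_even_odd f; use p in simp)+
  define u where "u = cesaro_op b g"
  define v where "v = cesaro_op (- a) h"
  obtain V where V: "0 < V" "\<And>M. (\<Sum>d<M. \<bar>cesaro a d\<bar> powr p) \<le> V"
    using sum_abs_cesaro_powr_bounded[of p a] p a by (smt (verit))
  define c where "c = (2::real) powr (p - 1)"
  have c: "c > 0" by (simp add: c_def)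
  \<comment> \<open>One share for the even coordinates; for the odd ones \<open>c * (1 + V)\<close>,
    where \<open>V\<close> bounds the unpaired vector that remains when the number of terms is
    odd.\<close>
  define \<eta> where "\<eta> = \<epsilon> / (1 + c * (1 + V))"
  have pos: "1 + c * (1 + V) > 0" using c V by (intro add_pos_pos mult_pos_pos) auto
  have \<eta>: "\<eta> > 0" unfolding \<eta>_def using \<epsilon> pos by (intro divide_pos_pos)
  define Rg where "Rg N i = g i - cesaro_op (- b) (\<lambda>n. if n < N then u n else 0) i" for N i
  define Rh where "Rh N i = h i - cesaro_op a (\<lambda>n. if n < N then v n else 0) i" for N i
  have "\<forall>\<^sub>F N in sequentially. \<forall>M. (\<Sum>i<M. norm (Rg N i) powr p) \<le> \<eta>"
    using cesaro_remainder_small[of p "- b", OF p _ _ g \<eta>, unfolded minus_minus] b p1 by (simp add: Rg_def u_def cong: if_cong)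
  moreover have "\<forall>\<^sub>F N in sequentially. \<forall>M. (\<Sum>i<M. norm (Rh N i) powr p) \<le> \<eta>"
    using cesaro_remainder_small[of p a, OF p _ _ h \<eta>] a p1 by (simp add: Rh_def v_def cong: if_cong)
  ultimately have "\<forall>\<^sub>F N in sequentially. (\<forall>M. (\<Sum>i<M. norm (Rg N i) powr p) \<le> \<eta>) \<and> (\<forall>M. (\<Sum>i<M. norm (Rh N i) powr p) \<le> \<eta>)"
    by (rule eventually_conj)
  then obtain N0 where Rg: "\<And>N M. N \<ge> N0 \<Longrightarrow> (\<Sum>i<M. norm (Rg N i) powr p) \<le> \<eta>"
    and Rh: "\<And>N M. N \<ge> N0 \<Longrightarrow> (\<Sum>i<M. norm (Rh N i) powr p) \<le> \<eta>"
    unfolding eventually_sequentially by blast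
  \<comment> \<open>An odd number of terms leaves one vector \<open>(x\<^sub>n, y\<^sub>n)\<close>
    without its partner, so its coefficient must tend to zero. That coefficient is the entry at
    position \<open>N\<close> of the \<open>N\<close>-th remainder and is controlled by it.\<close>
  have u_small: "norm (u N) powr p \<le> \<eta>" if "N \<ge> N0" for N
  proof -
    have "g N = cesaro_op (- b) u N" by (simp add: u_def cesaro_op_add)
    then have "Rg N N = cesaro_op (- b) (\<lambda>n. u n - (if n < N then u n else 0)) N"
      by (simp add: Rg_def cesaro_op_diff)
    also have "\<dots> = cesaro_op (- b) (\<lambda>n. if n \<in> {N} then u N else 0) N"
      by (intro cesaro_op_cong) auto
    also have "\<dots> = u N"
      by (subst sum_cesaro_vec[symmetric]) (auto simp: cesaro_vec_def)
    finally have "Rg N N = u N" .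
    then show ?thesis
      using order_trans[OF member_le_sum[of N "{..<Suc N}" "\<lambda>i. norm (Rg N i) powr p"] Rg[OF that]] by simp
  qed
  show "\<forall>\<^sub>F M in sequentially. \<forall>L. (\<Sum>i<L. norm (f i - (\<Sum>n<M. mixed_coeff a b f n * mixed_basis a b n i)) powr p) \<le> \<epsilon>"
    using eventually_ge_at_top[of "2 * N0"]
  proof eventually_elim
    case (elim M)
    define K where "K = M div 2"
    have K: "K \<ge> N0" "(M + 1) div 2 \<ge> N0" using elim by (auto simp: K_def)
    define T where "T i = f i - (\<Sum>n<M. mixed_coeff a b f n * mixed_basis a b n i)" for i
    have coeff: "mixed_coeff a b f (2 * k) = u k" "mixed_coeff a b f (2 * k + 1) = v k - u k" for k
      by (auto simp: mixed_coeff_def u_def v_def g_def[abs_def] h_def[abs_def])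
    have T_even: "T (2 * j) = Rg ((M + 1) div 2) j" for j
    proof -
      have "2 * k < M \<longleftrightarrow> k < (M + 1) div 2" for k by linarith
      then show ?thesis
        by (simp add: T_def Rg_def g_def sum_mixed_basis_even coeff cong: if_cong)
    qed
    \<comment> \<open>In a complete pair the coefficients \<open>u k\<close> and
      \<open>v k - u k\<close> add up to \<open>v k\<close>; only an unpaired index \<open>K\<close>
      contributes \<open>u K\<close> times a column.\<close>
    have T_odd: "norm (T (2 * j + 1)) \<le> norm (Rh K j) + norm (u K) * norm (cesaro_vec a K j :: 'k)" for j
    proof -
      have "T (2 * j + 1) = h j - cesaro_op a (\<lambda>k. (if 2 * k < M then u k else 0) + (if 2 * k + 1 < M then v k - u k else 0)) j"
        using sum_mixed_basis_odd[of "{..<M}" "mixed_coeff a b f" a b j] unfolding coeff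
        by (simp add: T_def h_def)
      also have "cesaro_op a (\<lambda>k. (if 2 * k < M then u k else 0) + (if 2 * k + 1 < M then v k - u k else 0)) j
        = cesaro_op a (\<lambda>k. (if k < K then v k else 0) + (if k \<in> (if odd M then {K} else {}) then u k else 0)) j"
        by (intro cesaro_op_cong) (auto simp: K_def elim!: oddE evenE)
      also have "\<dots> = cesaro_op a (\<lambda>k. if k < K then v k else 0) j
        + (\<Sum>k\<in>(if odd M then {K} else {}). u k * cesaro_vec a k j)"
        unfolding cesaro_op_plus by (subst sum_cesaro_vec) auto
      finally have "T (2 * j + 1) = Rh K j - (if odd M then u K * cesaro_vec a K j else 0)"
        by (simp add: Rh_def)
      then show ?thesis
        using norm_triangle_ineq4[of "Rh K j" "u K * cesaro_vec a K j"] by (auto simp: norm_mult)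
    qed
    show ?case
    proof
      fix L
      have "(\<Sum>i<L. norm (T i) powr p) \<le> (\<Sum>j<L. norm (T (2 * j)) powr p) + (\<Sum>j<L. norm (T (2 * j + 1)) powr p)"
        by (rule sum_even_odd_ge) simp
      also have "(\<Sum>j<L. norm (T (2 * j)) powr p) \<le> \<eta>"
        unfolding T_even by (intro Rg K)
      also have "(\<Sum>j<L. norm (T (2 * j + 1)) powr p)
          \<le> (\<Sum>j<L. c * (norm (Rh K j) powr p + (norm (u K) * norm (cesaro_vec a K j :: 'k)) powr p))"
      proof (intro sum_mono)
        fix j
        have "norm (T (2 * j + 1)) powr p \<le> (norm (Rh K j) + norm (u K) * norm (cesaro_vec a K j :: 'k)) powr p"
          by (intro powr_mono2 T_odd) (use p in auto)
        also have "\<dots> \<le> c * (norm (Rh K j) powr p + (norm (u K) * norm (cesaro_vec a K j :: 'k)) powr p)"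
          unfolding c_def by (rule add_powr_le) (use p in auto)
        finally show "norm (T (2 * j + 1)) powr p \<le> c * (norm (Rh K j) powr p + (norm (u K) * norm (cesaro_vec a K j :: 'k)) powr p)" .
      qed
      also have "\<dots> = c * ((\<Sum>j<L. norm (Rh K j) powr p) + norm (u K) powr p * (\<Sum>j<L. norm (cesaro_vec a K j :: 'k) powr p))"
        by (simp only: powr_mult norm_ge_zero sum_distrib_left[symmetric] sum.distrib)
      also have "\<dots> \<le> c * (\<eta> + \<eta> * V)"
        by (intro mult_left_mono add_mono mult_mono Rh K u_small sum_cesaro_vec_powr_le V)
           (use c \<eta> in \<open>auto intro: sum_nonneg\<close>)
      also have "\<eta> + c * (\<eta> + \<eta> * V) = \<eta> * (1 + c * (1 + V))" by (simp add: algebra_simps)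
      also have "\<dots> = \<epsilon>" using pos by (auto simp: \<eta>_def)
      finally show "(\<Sum>i<L. norm (f i - (\<Sum>n<M. mixed_coeff a b f n * mixed_basis a b n i)) powr p) \<le> \<epsilon>"
        by (simp add: T_def)
    qed
  qed
qed (use p in simp)

lemma mixed_basis_schauder:
  fixes f :: "nat \<Rightarrow> 'k::real_normed_field"
  assumes p: "1 < p" and a: "0 \<le> a" "a < 1 - 1 / p" and b: "0 \<le> b" "b < 1 / p"
  shows "schauder_basis (lp_space p) (lp_norm p) (mixed_basis a b :: nat \<Rightarrow> nat \<Rightarrow> 'k)"
    and "f \<in> lp_space p \<Longrightarrow> coord_functional (lp_norm p) (mixed_basis a b) n f = mixed_coeff a b f n"
proof -
  have lp: "(mixed_basis a b n :: nat \<Rightarrow> 'k) \<in> lp_space p" for n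
    by (rule mixed_basis_in_lp_space) (use assms in auto)
  have tri: "mixed_basis a b n i = (0 :: 'k)" if "i < n" for n i
  proof (cases "i div 2 < n div 2")
    case False
    with that have "even i" "odd n" by presburger+
    then show ?thesis by (simp add: mixed_basis_def)
  qed (simp add: mixed_basis_def cesaro_vec_def)
  have diag: "mixed_basis a b n n \<noteq> (0 :: 'k)" for n
    by (simp add: mixed_basis_def cesaro_vec_def)
  note * = triangular_schauder_basis[of p "mixed_basis a b" "mixed_coeff a b", OF p lp tri diag mixed_basis_expands[OF assms]]
  show "schauder_basis (lp_space p) (lp_norm p) (mixed_basis a b :: nat \<Rightarrow> nat \<Rightarrow> 'k)"
    by (rule *(1))
  show "f \<in> lp_space p \<Longrightarrow> coord_functional (lp_norm p) (mixed_basis a b) n f = mixed_coeff a b f n"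
    by (rule *(2))
qed

text \<open>The projection reads \<open>cesaro_op b g\<close> at no more than \<open>m\<close>
  positions, which costs \<open>m powr b\<close>, and then applies \<open>cesaro_op a\<close> to a
  sequence with at most \<open>m\<close> nonzero entries, which costs \<open>m powr a\<close>. The
  operators with parameters \<open>- a\<close> and \<open>- b\<close> cost a factor 2 each.\<close>

lemma mixed_basis_upper:
  assumes p: "1 < p" and a: "0 \<le> a" "a < 1 - 1 / p" and b: "0 \<le> b" "b < 1 / p"
  obtains C where "0 < C"
    "\<And>m. 1 \<le> m \<Longrightarrow> conditionality_const (lp_space p) (lp_norm p) (mixed_basis a b :: nat \<Rightarrow> nat \<Rightarrow> 'k::real_normed_field) m
      \<le> ennreal (C * real m powr (a + b))"
proof -
  have p1: "1 / p < 1" "0 < 1 / p" using p by simp_all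
  have ab1: "a \<le> 1" "b \<le> 1" using a b p1 by linarith+
  obtain Ca where Ca: "0 < Ca"
    "\<And>m M B (f :: nat \<Rightarrow> 'k). 1 \<le> m \<Longrightarrow> finite B \<Longrightarrow> card B \<le> m \<Longrightarrow> (\<And>j. j \<notin> B \<Longrightarrow> f j = 0) \<Longrightarrow>
      (\<Sum>i<M. norm (cesaro_op a f i) powr p) \<le> Ca * real m powr (a * p) * (\<Sum>j<M. norm (f j) powr p)"
    using cesaro_op_restricted_input_bound[OF p a, where 'k = 'k] by blast
  obtain Cb where Cb: "0 < Cb"
    "\<And>m E (f :: nat \<Rightarrow> 'k) Q. 1 \<le> m \<Longrightarrow> finite E \<Longrightarrow> card E \<le> m \<Longrightarrow> (\<And>M. (\<Sum>j<M. norm (f j) powr p) \<le> Q) \<Longrightarrow>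
      (\<Sum>i\<in>E. norm (cesaro_op b f i) powr p) \<le> Cb * real m powr (b * p) * Q"
    using cesaro_op_restricted_output_bound[OF p b, where 'k = 'k] by blast
  define c where "c = (2::real) powr (p - 1)"
  have c: "c > 0" by (simp add: c_def)
  \<comment> \<open>The first term bounds the even coordinates. In the second,
    \<open>2 powr p * Cb\<close> comes from the estimate of an input entry by
    \<open>2 * norm (u k) + norm (v k)\<close>, and the last \<open>2 powr p\<close> is the bound
    for \<open>v\<close>.\<close>
  define D where "D = 2 powr p * Cb + Ca * (c * (2 powr p * Cb + 2 powr p))"
  have D: "D > 0" unfolding D_def using Ca(1) Cb(1) c by (intro add_pos_pos mult_pos_pos) auto
  show ?thesis
  proof (rule that[of "D powr (1 / p)"])
    fix m :: nat assume m: "1 \<le> m"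
    show "conditionality_const (lp_space p) (lp_norm p) (mixed_basis a b :: nat \<Rightarrow> nat \<Rightarrow> 'k) m
      \<le> ennreal (D powr (1 / p) * real m powr (a + b))"
      unfolding conditionality_const_def operator_norm_def
    proof (intro SUP_least)
      fix A :: "nat set" and f :: "nat \<Rightarrow> 'k"
      assume "A \<in> {A. finite A \<and> card A \<le> m}" and "f \<in> {f \<in> lp_space p. lp_norm p f \<le> 1}"
      then have A: "finite A" "card A \<le> m" and f: "f \<in> lp_space p" and f1: "lp_norm p f \<le> 1" by auto
      have "lp_norm p f powr p \<le> 1 powr p"
        using f1 p by (intro powr_mono2) auto
      then have f2: "lp_norm p f powr p \<le> 1" by simp
      define g where "g j = f (2 * j)" for j
      define h where "h j = f (2 * j + 1)" for j
      have g1: "(\<Sum>j<M. norm (g j) powr p) \<le> 1" for M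
        unfolding g_def by (rule order_trans[OF lp_space_even_odd(3)[OF _ f] f2]) (use p in simp)
      have h1: "(\<Sum>j<M. norm (h j) powr p) \<le> 1" for M
        unfolding h_def by (rule order_trans[OF lp_space_even_odd(4)[OF _ f] f2]) (use p in simp)
      define u where "u = cesaro_op b g"
      define v where "v = cesaro_op (- a) h"
      have coeff: "mixed_coeff a b f (2 * k) = u k" "mixed_coeff a b f (2 * k + 1) = v k - u k" for k
        by (auto simp: mixed_coeff_def u_def v_def g_def[abs_def] h_def[abs_def])
      define T where "T i = (\<Sum>n\<in>A. mixed_coeff a b f n * mixed_basis a b n i)" for i
      define E where "E = {k. 2 * k \<in> A}"
      \<comment> \<open>The set of pairs touched by \<open>A\<close>; merging two indices of a pair
        into one does not increase the cardinality, so the restricted estimates apply with the same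
        \<open>m\<close>.\<close>
      define B where "B = E \<union> {k. 2 * k + 1 \<in> A}"
      have B: "finite B" "card B \<le> m"
      proof -
        have "B \<subseteq> (\<lambda>n. n div 2) ` A" unfolding B_def E_def by force
        then show "finite B" using A(1) by (rule finite_surj[rotated])
        show "card B \<le> m"
          using surj_card_le[OF A(1) \<open>B \<subseteq> _\<close>] A(2) by simp
      qed
      have E: "E \<subseteq> B" by (simp add: B_def)
      have bp: "real m powr (b * p) \<ge> 1" and ap: "real m powr (a * p) \<ge> 1"
        using m p a b by (auto intro!: ge_one_powr_ge_zero)
      have u_B: "(\<Sum>j\<in>B. norm (u j) powr p) \<le> Cb * real m powr (b * p)"
        using Cb(2)[OF m B g1] by (simp add: u_def)
      have v_M: "(\<Sum>j<M. norm (v j) powr p) \<le> 2 powr p * real m powr (b * p)" for M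
      proof -
        have "(\<Sum>j<M. norm (v j) powr p) \<le> 2 powr p * (\<Sum>j<M. norm (h j) powr p)"
          unfolding v_def by (rule cesaro_op_minus_bounded) (use p a ab1 in auto)
        also have "\<dots> \<le> 2 powr p * real m powr (b * p)"
          by (intro mult_left_mono order_trans[OF h1 bp]) auto
        finally show ?thesis .
      qed
      have T_even: "(\<Sum>j<M. norm (T (2 * j)) powr p) \<le> 2 powr p * Cb * real m powr (b * p)" for M
      proof -
        define uE where "uE k = (if k \<in> E then u k else 0)" for k
        have "T (2 * j) = cesaro_op (- b) uE j" for j
          unfolding T_def sum_mixed_basis_even[OF A(1)] coeff by (simp add: uE_def[abs_def] E_def)
        then have "(\<Sum>j<M. norm (T (2 * j)) powr p) \<le> 2 powr p * (\<Sum>j<M. norm (uE j) powr p)"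
          using cesaro_op_minus_bounded[of p b uE M] p b ab1 by simp
        also have "(\<Sum>j<M. norm (uE j) powr p) \<le> (\<Sum>j\<in>B. norm (u j) powr p)"
        proof -
          have "(\<Sum>j<M. norm (uE j) powr p) = (\<Sum>j\<in>E \<inter> {..<M}. norm (u j) powr p)"
            using p by (intro sum.mono_neutral_cong_right) (auto simp: uE_def)
          also have "\<dots> \<le> (\<Sum>j\<in>B. norm (u j) powr p)"
            using B E by (intro sum_mono2) auto
          finally show ?thesis .
        qed
        also note u_B
        finally show ?thesis by (simp add: mult_ac)
      qed
      have T_odd: "(\<Sum>j<M. norm (T (2 * j + 1)) powr p)
        \<le> Ca * real m powr (a * p) * (c * (2 powr p * (Cb * real m powr (b * p)) + 2 powr p * real m powr (b * p)))" for M
      proof -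
        define w where "w k = (if 2 * k \<in> A then u k else 0) + (if 2 * k + 1 \<in> A then v k - u k else 0)" for k
        have w0: "w k = 0" if "k \<notin> B" for k using that by (simp add: w_def B_def E_def)
        have w_le: "norm (w k) powr p \<le> c * ((2 * norm (u k)) powr p + norm (v k) powr p)" for k
        proof -
          have "norm (w k) \<le> 2 * norm (u k) + norm (v k)"
          proof -
            have "norm (w k) = norm (v k) \<or> norm (w k) = norm (u k) \<or> norm (w k) = norm (v k - u k) \<or> norm (w k) = 0"
              by (auto simp: w_def)
            then show ?thesis
              using norm_triangle_ineq4[of "v k" "u k"] norm_ge_zero[of "u k"] norm_ge_zero[of "v k"] by linarith
          qed
          then have "norm (w k) powr p \<le> (2 * norm (u k) + norm (v k)) powr p"
            using p by (intro powr_mono2) auto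
          also have "\<dots> \<le> c * ((2 * norm (u k)) powr p + norm (v k) powr p)"
            unfolding c_def by (rule add_powr_le) (use p in auto)
          finally show ?thesis .
        qed
        have "T (2 * j + 1) = cesaro_op a w j" for j
          unfolding T_def sum_mixed_basis_odd[OF A(1)] coeff by (simp add: w_def[abs_def])
        then have "(\<Sum>j<M. norm (T (2 * j + 1)) powr p) \<le> Ca * real m powr (a * p) * (\<Sum>j<M. norm (w j) powr p)"
          using Ca(2)[of m B w M] m B w0 by simp
        also have "(\<Sum>j<M. norm (w j) powr p) = (\<Sum>j\<in>B \<inter> {..<M}. norm (w j) powr p)"
          using p w0 by (intro sum.mono_neutral_right) auto
        also have "\<dots> \<le> (\<Sum>j\<in>B \<inter> {..<M}. c * ((2 * norm (u j)) powr p + norm (v j) powr p))"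
          by (intro sum_mono w_le)
        also have "\<dots> = c * (2 powr p * (\<Sum>j\<in>B \<inter> {..<M}. norm (u j) powr p) + (\<Sum>j\<in>B \<inter> {..<M}. norm (v j) powr p))"
          by (simp add: powr_mult sum_distrib_left[symmetric] sum.distrib)
        also have "\<dots> \<le> c * (2 powr p * (Cb * real m powr (b * p)) + 2 powr p * real m powr (b * p))"
        proof (intro mult_left_mono add_mono)
          show "(\<Sum>j\<in>B \<inter> {..<M}. norm (u j) powr p) \<le> Cb * real m powr (b * p)"
            using B by (intro order_trans[OF sum_mono2 u_B]) auto
          show "(\<Sum>j\<in>B \<inter> {..<M}. norm (v j) powr p) \<le> 2 powr p * real m powr (b * p)"
            by (intro order_trans[OF sum_mono2 v_M[of M]]) auto
        qed (use c in auto)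
        finally show ?thesis using Ca(1) by (simp add: mult_left_mono)
      qed
      have T: "(\<Sum>i<M. norm (T i) powr p) \<le> D * real m powr ((a + b) * p)" for M
      proof -
        have "(\<Sum>i<M. norm (T i) powr p) \<le> (\<Sum>j<M. norm (T (2 * j)) powr p) + (\<Sum>j<M. norm (T (2 * j + 1)) powr p)"
          by (rule sum_even_odd_ge) simp
        also have "\<dots> \<le> real m powr (a * p) * (2 powr p * Cb * real m powr (b * p))
          + Ca * real m powr (a * p) * (c * (2 powr p * (Cb * real m powr (b * p)) + 2 powr p * real m powr (b * p)))"
        proof (intro add_mono T_odd order_trans[OF T_even])
          show "2 powr p * Cb * real m powr (b * p) \<le> real m powr (a * p) * (2 powr p * Cb * real m powr (b * p))"
            using mult_right_mono[OF ap, of "2 powr p * Cb * real m powr (b * p)"] Cb(1) by simp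
        qed
        also have "\<dots> = D * (real m powr (a * p) * real m powr (b * p))"
          by (simp add: D_def algebra_simps)
        also have "real m powr (a * p) * real m powr (b * p) = real m powr ((a + b) * p)"
          by (simp add: powr_add[symmetric] algebra_simps)
        finally show ?thesis .
      qed
      have "coord_projection (lp_norm p) (mixed_basis a b) A f = T"
        by (simp add: coord_projection_def T_def fun_eq_iff mixed_basis_schauder(2)[OF assms f])
      moreover have "lp_norm p T \<le> (D * real m powr ((a + b) * p)) powr (1 / p)"
        by (rule lp_normI(2)[OF _ T]) (use p in auto)
      moreover have "(D * real m powr ((a + b) * p)) powr (1 / p) = D powr (1 / p) * real m powr (a + b)"
        using p D by (simp add: powr_mult powr_powr)
      ultimately show "ennreal (lp_norm p (coord_projection (lp_norm p) (mixed_basis a b) A f))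
          \<le> ennreal (D powr (1 / p) * real m powr (a + b))"
        by (intro ennreal_leI) simp
    qed
  qed (use D in simp)
qed

text \<open>The test vector has zero odd part: its coefficients along the two kinds of vectors are
  \<open>u\<close> and \<open>- u\<close>. Keeping the first kind up to \<open>m\<close> exposes the
  sum of the first \<open>m\<close> vectors \<open>y\<^sub>n\<close>, whose size is of order
  \<open>m powr (1 / p + a)\<close>, while the even part is of order
  \<open>m powr (1 / p - b)\<close>.\<close>

lemma mixed_basis_lower:
  assumes p: "1 < p" and a: "0 \<le> a" "a < 1 - 1 / p" and b: "0 \<le> b" "b < 1 / p"
  obtains C where "0 < C"
    "\<And>m. 1 \<le> m \<Longrightarrow> ennreal (C * real m powr (a + b))
      \<le> conditionality_const (lp_space p) (lp_norm p) (mixed_basis a b :: nat \<Rightarrow> nat \<Rightarrow> 'k::real_normed_field) m"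
proof -
  have p1: "1 / p < 1" "0 < 1 / p" using p by simp_all
  have b1: "b < 1" "b * p < 1" using b p p1 by (linarith, simp add: field_simps)
  obtain Cb where Cb: "0 < Cb" "\<And>n. cesaro (1 + - b) n \<le> Cb * (real n + 1) powr - b"
    using cesaro_growth[of "- b"] b1 by (metis neg_less_iff_less)
  obtain Ca where Ca: "0 < Ca" "\<And>n. Ca * (real n + 1) powr a \<le> cesaro (1 + a) n"
    using cesaro_growth[of a] a by (metis less_le_trans neg_less_0_iff_less zero_less_one)
  define P where "P = Cb powr p / (1 - b * p)"
  have P: "P > 0" using Cb b1 by (simp add: P_def)
  \<comment> \<open>The p-th power of the projected vector, before scaling, is at least
    \<open>Ca powr p / (1 + a * p)\<close> times \<open>m powr (1 + a * p)\<close>, that of the test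
    vector at most \<open>P * m powr (1 - b * p)\<close>; \<open>D\<close> is the quotient of the
    constants.\<close>
  define D where "D = Ca powr p / (1 + a * p) / P"
  have ap: "1 + a * p > 0" using a p by (simp add: add_pos_nonneg)
  have D: "D > 0" using Ca P ap by (simp add: D_def)
  show ?thesis
  proof (rule that[of "D powr (1 / p)"])
    fix m :: nat assume m: "1 \<le> m"
    \<comment> \<open>Normalisation: it brings the test vector into the unit ball by the upper bound
      on its norm.\<close>
    define \<sigma> where "\<sigma> = (P * real m powr (1 - b * p)) powr - (1 / p)"
    have \<sigma>: "\<sigma> > 0" using P m by (simp add: \<sigma>_def)
    have \<sigma>p: "\<sigma> powr p = 1 / (P * real m powr (1 - b * p))"
    proof -
      have "\<sigma> powr p = (P * real m powr (1 - b * p)) powr - 1"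
        using p by (simp add: \<sigma>_def powr_powr)
      also have "\<dots> = 1 / (P * real m powr (1 - b * p))"
        using P by (subst powr_minus_divide) simp
      finally show ?thesis .
    qed
    \<comment> \<open>a multiple of the sum of the first \<open>m\<close> vectors \<open>(x\<^sub>n, 0)\<close>, cut off after \<open>m\<close> coordinates: the cut
      does not affect the first \<open>m\<close> coefficients\<close>
    define f where "f i = (if even i \<and> i div 2 < m then of_real (\<sigma> * cesaro (1 - b) (i div 2)) else 0 :: 'k)" for i
    have nonneg: "cesaro (1 - b) n \<ge> 0" for n using b1 by (intro cesaro_nonneg) auto
    have f_le: "(\<Sum>i<M. norm (f i) powr p) \<le> 1" for M
    proof -
      have "(\<Sum>i<M. norm (f i) powr p) \<le> (\<Sum>j<M. norm (f (2 * j)) powr p) + (\<Sum>j<M. norm (f (2 * j + 1)) powr p)"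
        by (rule sum_even_odd_ge) simp
      also have "\<dots> = (\<Sum>j<M. norm (f (2 * j)) powr p)" using p by (simp add: f_def)
      also have "\<dots> = (\<Sum>j\<in>{..<M} \<inter> {..<m}. (\<sigma> * cesaro (1 - b) j) powr p)"
        using p \<sigma> nonneg by (intro sum.mono_neutral_cong_right) (auto simp: f_def norm_mult)
      also have "\<dots> \<le> (\<Sum>j<m. (\<sigma> * cesaro (1 - b) j) powr p)"
        by (intro sum_mono2) auto
      also have "\<dots> \<le> (\<Sum>j<m. (\<sigma> * (Cb * (real j + 1) powr - b)) powr p)"
        using Cb(2) p \<sigma> nonneg by (intro sum_mono powr_mono2 mult_left_mono) auto
      also have "\<dots> = \<sigma> powr p * Cb powr p * (\<Sum>j<m. (real j + 1) powr - (b * p))"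
        using \<sigma> Cb by (simp add: sum_distrib_left powr_mult powr_powr mult_ac)
      also have "\<dots> \<le> \<sigma> powr p * Cb powr p * (real m powr (1 - b * p) / (1 - b * p))"
        by (intro mult_left_mono sum_powr_minus_le) (use b p b1 in auto)
      also have "\<dots> = \<sigma> powr p * (P * real m powr (1 - b * p))" by (simp add: P_def)
      also have "\<dots> = 1" using P m by (simp add: \<sigma>p)
      finally show ?thesis .
    qed
    have f: "f \<in> lp_space p" "lp_norm p f \<le> 1"
      using lp_normI[OF _ f_le] p by auto
    define A where "A = (\<lambda>n. 2 * n) ` {..<m}"
    have A: "finite A" "card A \<le> m"
      unfolding A_def using card_image_le[of "{..<m}" "\<lambda>n. 2 * n"] by auto
    have coeff: "mixed_coeff a b f (2 * k) = of_real \<sigma>" if "k < m" for k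
    proof -
      have "mixed_coeff a b f (2 * k) = (\<Sum>j\<le>k. of_real (cesaro b (k - j)) * f (2 * j))"
        by (simp add: mixed_coeff_def cesaro_op_def)
      also have "\<dots> = (\<Sum>j\<le>k. of_real (\<sigma> * (cesaro (1 - b) j * cesaro b (k - j))))"
        using that by (intro sum.cong) (auto simp: f_def)
      \<comment> \<open>The parameters add up to 1, and \<open>cesaro 1\<close> is constantly
        1.\<close>
      also have "\<dots> = of_real (\<sigma> * cesaro (1 - b + b) k)"
        unfolding cesaro_add sum_distrib_left of_real_sum ..
      finally show ?thesis by simp
    qed
    define T where "T i = (\<Sum>n\<in>A. mixed_coeff a b f n * mixed_basis a b n i)" for i
    have T: "T \<in> lp_space p"
      unfolding T_def by (intro lp_space_sum p mixed_basis_in_lp_space) (use a b in auto)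
    have T_odd: "T (2 * j + 1) = of_real (\<sigma> * cesaro (1 + a) j)" if "j < m" for j
    proof -
      have "T (2 * j + 1) = cesaro_op a (\<lambda>k. if k < m then of_real \<sigma> else 0) j"
        unfolding T_def sum_mixed_basis_odd[OF A(1)]
        by (intro cesaro_op_cong) (auto simp: A_def coeff, presburger)
      also have "\<dots> = of_real (\<sigma> * (\<Sum>k\<le>j. cesaro a (j - k)))"
        using that by (simp add: cesaro_op_def sum_distrib_left mult_ac)
      also have "(\<Sum>k\<le>j. cesaro a (j - k)) = (\<Sum>k\<le>j. cesaro a k)"
        by (rule sum.reindex_bij_witness[where j = "\<lambda>k. j - k" and i = "\<lambda>k. j - k"]) auto
      finally show ?thesis by (simp add: sum_cesaro)
    qed
    have "D * real m powr ((a + b) * p) = \<sigma> powr p * Ca powr p * (real m powr (1 + a * p) / (1 + a * p))"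
    proof -
      have "real m powr (1 + a * p) = real m powr (1 - b * p) * real m powr ((a + b) * p)"
        by (simp add: powr_add[symmetric] algebra_simps)
      then show ?thesis using m P by (simp add: \<sigma>p D_def)
    qed
    also have "\<dots> \<le> \<sigma> powr p * Ca powr p * (\<Sum>j<m. (real j + 1) powr (a * p))"
      by (intro mult_left_mono sum_powr_ge) (use a p in auto)
    also have "\<dots> = (\<Sum>j<m. (\<sigma> * (Ca * (real j + 1) powr a)) powr p)"
      using \<sigma> Ca by (simp add: sum_distrib_left powr_mult powr_powr mult_ac)
    also have "\<dots> \<le> (\<Sum>j<m. norm (T (2 * j + 1)) powr p)"
    proof (intro sum_mono powr_mono2)
      fix j assume "j \<in> {..<m}"
      then have "norm (T (2 * j + 1)) = \<sigma> * cesaro (1 + a) j"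
        using \<sigma> cesaro_nonneg[of "1 + a" j] a by (simp add: T_odd[simplified] norm_mult)
      then show "\<sigma> * (Ca * (real j + 1) powr a) \<le> norm (T (2 * j + 1))"
        using Ca(2)[of j] \<sigma> by simp
    qed (use p \<sigma> Ca in auto)
    also have "\<dots> = (\<Sum>i\<in>(\<lambda>j. 2 * j + 1) ` {..<m}. norm (T i) powr p)"
      by (subst sum.reindex) (auto simp: inj_on_def)
    also have "\<dots> \<le> lp_norm p T powr p"
      by (rule sum_le_lp_norm) (use p T in auto)
    finally have "(D * real m powr ((a + b) * p)) powr (1 / p) \<le> (lp_norm p T powr p) powr (1 / p)"
      using D p by (intro powr_mono2) auto
    then have "D powr (1 / p) * real m powr (a + b) \<le> lp_norm p T"
      using D p by (simp add: powr_mult powr_powr)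
    moreover have "coord_projection (lp_norm p) (mixed_basis a b) A f = T"
      by (simp add: coord_projection_def T_def fun_eq_iff mixed_basis_schauder(2)[OF assms f(1)])
    ultimately have "ennreal (D powr (1 / p) * real m powr (a + b))
        \<le> ennreal (lp_norm p (coord_projection (lp_norm p) (mixed_basis a b) A f))"
      by (intro ennreal_leI) simp
    also have "\<dots> \<le> operator_norm (lp_space p) (lp_norm p) (coord_projection (lp_norm p) (mixed_basis a b :: nat \<Rightarrow> nat \<Rightarrow> 'k) A)"
      unfolding operator_norm_def by (rule SUP_upper) (use f in auto)
    also have "\<dots> \<le> conditionality_const (lp_space p) (lp_norm p) (mixed_basis a b :: nat \<Rightarrow> nat \<Rightarrow> 'k) m"
      unfolding conditionality_const_def by (rule SUP_upper) (use A in auto)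
    finally show "ennreal (D powr (1 / p) * real m powr (a + b))
      \<le> conditionality_const (lp_space p) (lp_norm p) (mixed_basis a b :: nat \<Rightarrow> nat \<Rightarrow> 'k) m" .
  qed (use D in simp)
qed

text \<open>The kernels are real and enter through \<open>of_real\<close>, so one argument over an
  arbitrary real normed field covers real and complex scalars.\<close>

lemma exists_basis_with_conditionality_growth:
  fixes \<alpha> p :: real
  assumes \<alpha>: "0 \<le> \<alpha>" "\<alpha> < 1" and p: "1 < p"
  shows "\<exists>X :: nat \<Rightarrow> nat \<Rightarrow> 'k::real_normed_field.
    schauder_basis (lp_space p) (lp_norm p) X \<and>
    equiv_growth (conditionality_const (lp_space p) (lp_norm p) X) (\<lambda>m. real m powr \<alpha>)"
proof -
  define a where "a = \<alpha> * (1 - 1 / p)"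
  define b where "b = \<alpha> / p"
  have ab: "a + b = \<alpha>" by (simp add: a_def b_def algebra_simps)
  have a: "0 \<le> a" "a < 1 - 1 / p"
    using \<alpha> p mult_strict_right_mono[of \<alpha> 1 "1 - 1 / p"] by (auto simp: a_def)
  have b: "0 \<le> b" "b < 1 / p"
    using \<alpha> p by (auto simp: b_def divide_strict_right_mono)
  obtain C where C: "0 < C" "\<And>m. 1 \<le> m \<Longrightarrow> conditionality_const (lp_space p) (lp_norm p)
      (mixed_basis a b :: nat \<Rightarrow> nat \<Rightarrow> 'k) m \<le> ennreal (C * real m powr (a + b))"
    using mixed_basis_upper[OF p a b] by blast
  obtain c where c: "0 < c" "\<And>m. 1 \<le> m \<Longrightarrow> ennreal (c * real m powr (a + b)) \<le>
      conditionality_const (lp_space p) (lp_norm p) (mixed_basis a b :: nat \<Rightarrow> nat \<Rightarrow> 'k) m"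
    using mixed_basis_lower[OF p a b] by blast
  have "equiv_growth (conditionality_const (lp_space p) (lp_norm p) (mixed_basis a b :: nat \<Rightarrow> nat \<Rightarrow> 'k))
      (\<lambda>m. real m powr \<alpha>)"
    unfolding equiv_growth_def
  proof (intro exI conjI allI impI)
    fix m :: nat assume m: "1 \<le> m"
    show "ennreal (c * real m powr \<alpha>) \<le> conditionality_const (lp_space p) (lp_norm p) (mixed_basis a b :: nat \<Rightarrow> nat \<Rightarrow> 'k) m"
      using c(2)[OF m] by (simp add: ab)
    have "C * real m powr \<alpha> \<le> max c C * real m powr \<alpha>" by (intro mult_right_mono) auto
    then show "conditionality_const (lp_space p) (lp_norm p) (mixed_basis a b :: nat \<Rightarrow> nat \<Rightarrow> 'k) m \<le> ennreal (max c C * real m powr \<alpha>)"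
      unfolding ab[symmetric] by (rule order_trans[OF C(2)[OF m] ennreal_leI])
  qed (use c in auto)
  with mixed_basis_schauder(1)[OF p a b] show ?thesis by blast
qed

theorem theorem1p4:
  fixes \<alpha> p :: real
  assumes "0 \<le> \<alpha>" and "\<alpha> < 1" and "1 < p"
  shows "(\<exists>X :: nat \<Rightarrow> nat \<Rightarrow> real.
            schauder_basis (lp_space p) (lp_norm p) X \<and>
            equiv_growth (conditionality_const (lp_space p) (lp_norm p) X) (\<lambda>m. real m powr \<alpha>))
          \<and> (\<exists>X :: nat \<Rightarrow> nat \<Rightarrow> complex.
            schauder_basis (lp_space p) (lp_norm p) X \<and>
            equiv_growth (conditionality_const (lp_space p) (lp_norm p) X) (\<lambda>m. real m powr \<alpha>))"
  by (intro conjI exists_basis_with_conditionality_growth assms)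

end
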